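(* Let $K$ be a field. Let $f : \mathbb{Z}_{\geq 0} \setminus \{0\} \to \mathbb{Z}_{\geq 0}$ be a nonincreasing function such that (i) $f(k) - f(k+1) \leq 1$ for all $k \geq 1$; and (ii) if $a = f(1)$ and $b = \lim_{k \to \infty} f(k)$, then $$|f^{-1}(a)| \leq |f^{-1}(a-1)| \leq \cdots \leq |f^{-1}(b+1)|.$$ Then there exist a polynomial ring $S = K[x_1, \ldots, x_n]$ in finitely many variables over $K$ and a monomial ideal $I \subset S$ such that $\operatorname{depth} S/I^k = f(k)$ for all integers $k \geq 1$.
   Context: $S = K[x_1,\ldots,x_n]$ is the standard graded polynomial ring over a field $K$, with each $\deg x_i = 1$. A monomial ideal is an ideal generated by monomials. For a finitely generated graded $S$-module $M$, $\operatorname{depth} M$ denotes its depth with respect to the graded maximal ideal $(x_1,\ldots,x_n)$. "Nonincreasing" means $f(k+1) \leq f(k)$ for all $k \geq 1$. The chain of inequalities in (ii) runs over the values $a, a-1, \ldots, b+1$; it is vacuous when $a = b$. *)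

theory Defs
  imports
    Complex_Main
    "HOL-Library.Poly_Mapping"
    "HOL-Library.Extended_Nat"
    "HOL-Algebra.QuotRing"
    "HOL-Algebra.Ideal_Product"
    "HOL-Algebra.Module"
begin

section \<open>Modules and depth\<close>

definition regular_module :: "('a, 'c) ring_scheme \<Rightarrow> ('a, 'a) module" where
  "regular_module R =
    \<lparr>carrier = carrier R, mult = mult R, one = one R, zero = zero R, add = add R,
     smult = mult R\<rparr>"

text \<open>The quotient \<open>M/N\<close> of a module by a submodule.  The fields \<open>mult\<close> and \<open>one\<close>, which a
  module record inherits from \<open>ring\<close>, are irrelevant to the module structure; they are
  filled in as in \<^const>\<open>FactRing\<close>.\<close>

definition quot_module :: "('a, 'b, 'c) module_scheme \<Rightarrow> 'b set \<Rightarrow> ('a, 'b set) module" where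
  "quot_module M N =
    \<lparr>carrier = a_rcosets\<^bsub>M\<^esub> N, mult = rcoset_mult M N, one = N +>\<^bsub>M\<^esub> \<one>\<^bsub>M\<^esub>,
     zero = N, add = set_add M,
     smult = (\<lambda>r X. \<Union>x\<in>X. N +>\<^bsub>M\<^esub> (r \<odot>\<^bsub>M\<^esub> x))\<rparr>"

text \<open>The submodule \<open>J M\<close>, generated by the products \<open>r m\<close> with \<open>r \<in> J\<close> and \<open>m \<in> M\<close>.
  For an ideal generated by a set \<open>X\<close> it is also the submodule \<open>X M\<close>, so \<open>J\<close> may be any
  set of ring elements.\<close>

definition set_smult ::
    "('a, 'c) ring_scheme \<Rightarrow> 'a set \<Rightarrow> ('a, 'b, 'd) module_scheme \<Rightarrow> 'b set" where
  "set_smult R J M =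
    \<Inter>{N. submodule N R M \<and> {r \<odot>\<^bsub>M\<^esub> m | r m. r \<in> J \<and> m \<in> carrier M} \<subseteq> N}"

definition regular_element ::
    "('a, 'c) ring_scheme \<Rightarrow> ('a, 'b, 'd) module_scheme \<Rightarrow> 'a \<Rightarrow> bool" where
  "regular_element R M r \<longleftrightarrow>
    r \<in> carrier R \<and> (\<forall>m\<in>carrier M. r \<odot>\<^bsub>M\<^esub> m = \<zero>\<^bsub>M\<^esub> \<longrightarrow> m = \<zero>\<^bsub>M\<^esub>)"

definition regular_sequence ::
    "('a, 'c) ring_scheme \<Rightarrow> ('a, 'b, 'd) module_scheme \<Rightarrow> 'a list \<Rightarrow> bool" where
  "regular_sequence R M rs \<longleftrightarrow>
    (\<forall>i<length rs.
       regular_element R (quot_module M (set_smult R (set (take i rs)) M)) (rs ! i)) \<and>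
    set_smult R (set rs) M \<noteq> carrier M"

text \<open>The depth (grade) of \<open>M\<close> with respect to an ideal \<open>J\<close>: the supremum of the lengths of
  the \<open>M\<close>-regular sequences in \<open>J\<close>, and \<open>\<infinity>\<close> by convention if \<open>J M = M\<close>.  For \<open>J\<close> the
  graded maximal ideal and \<open>M\<close> finitely generated graded, the latter happens only
  for \<open>M = 0\<close>.\<close>

definition depth ::
    "('a, 'c) ring_scheme \<Rightarrow> 'a set \<Rightarrow> ('a, 'b, 'd) module_scheme \<Rightarrow> enat" where
  "depth R J M =
    (if set_smult R J M = carrier M then \<infinity>
     else Sup {enat (length rs) | rs. set rs \<subseteq> J \<and> regular_sequence R M rs})"

section \<open>Polynomial rings and monomial ideals\<close>

text \<open>A polynomial maps exponent vectors of type \<^typ>\<open>nat \<Rightarrow>\<^sub>0 nat\<close> to coefficients.  The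
  variables of the polynomial ring in \<open>n\<close> variables are numbered \<open>0, \<dots>, n - 1\<close>.\<close>

type_synonym 'k mpoly = "(nat \<Rightarrow>\<^sub>0 nat) \<Rightarrow>\<^sub>0 'k"

definition exponents :: "nat \<Rightarrow> (nat \<Rightarrow>\<^sub>0 nat) set" where
  "exponents n = {e. Poly_Mapping.keys e \<subseteq> {..<n}}"

definition poly_ring :: "nat \<Rightarrow> 'k::field mpoly ring" where
  "poly_ring n =
    \<lparr>carrier = {p. Poly_Mapping.keys p \<subseteq> exponents n}, mult = (*), one = 1, zero = 0,
     add = (+)\<rparr>"

definition monomials :: "nat \<Rightarrow> 'k::field mpoly set" where
  "monomials n = (\<lambda>e. Poly_Mapping.single e 1) ` exponents n"

definition variables :: "nat \<Rightarrow> 'k::field mpoly set" where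
  "variables n = (\<lambda>i. Poly_Mapping.single (Poly_Mapping.single i 1) 1) ` {..<n}"

definition graded_maximal_ideal :: "nat \<Rightarrow> 'k::field mpoly set" where
  "graded_maximal_ideal n = genideal (poly_ring n) (variables n)"

definition monomial_ideal :: "nat \<Rightarrow> 'k::field mpoly set \<Rightarrow> bool" where
  "monomial_ideal n I \<longleftrightarrow> (\<exists>A\<subseteq>monomials n. I = genideal (poly_ring n) A)"

text \<open>The power \<open>I\<^sup>k\<close> is taken in the monoid of ideals of \<open>S\<close> under the ideal product.\<close>

definition depth_quotient_power :: "nat \<Rightarrow> 'k::field mpoly set \<Rightarrow> nat \<Rightarrow> enat" where
  "depth_quotient_power n I k =
    depth (poly_ring n) (graded_maximal_ideal n)
      (quot_module (regular_module (poly_ring n)) (I [^]\<^bsub>ideals_set (poly_ring n)\<^esub> k))"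

end

theory Submission
  imports Defs
begin

text \<open>The \<open>k\<close>-th power of \<open>J\<^sub>s = (x\<^bsup>s+1\<^esup>, x y\<^bsup>s-1\<^esup> z, y\<^bsup>s\<^esup> z)\<close> has depth 1 in \<open>K[x, y, z]\<close> for
  \<open>k \<le> s\<close>, where \<open>z - y\<close> is a nonzerodivisor, and depth 0 for \<open>k > s\<close>.  For copies of \<open>J\<^sub>s\<close> that
  share \<open>x\<close> but have separate variables \<open>y\<^sub>j, z\<^sub>j\<close>, these depths add up in the product
  \<open>I = x \<cdot> \<Prod>\<^sub>j J\<^bsub>s j\<^esub>\<close>, because a monomial lies in \<open>I\<^sup>k\<close> iff its \<open>x\<close>-exponent is at least \<open>k\<close> plus
  the sum of the \<open>x\<close>-exponents which the powers \<open>J\<^bsub>s j\<^esub>\<^sup>k\<close> require.  So with \<open>s j\<close> the number of \<open>k\<close>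
  such that \<open>f k > b + j\<close>, for \<open>j < a - b\<close>, and \<open>b\<close> further free variables \<open>w\<close>, the depth of \<open>S/I\<^sup>k\<close>
  is \<open>f k\<close>.

  A regular sequence is given by the differences \<open>z\<^sub>j - y\<^sub>j\<close> with \<open>k \<le> s j\<close> and \<open>w - x\<close>: dividing by a
  difference of two variables merges them, so the quotients stay monomial.  After the last step the
  quotient has a monomial in its socle.  By Koszul cohomology (a regular element \<open>y\<close> shifts the lowest
  nonvanishing degree of \<open>S/L\<close> down by one when passing to \<open>S/(L + yS)\<close>), no regular sequence can then be longer.\<close>

section \<open>Quotients of a subring as modules\<close>

text \<open>The shape of J_s comes from a coincidence among products of s + 1 generators: (x y^(s-1)
  z)^(s+1) = x^(s+1) y^(s^2-1) z^(s+1) and x^(s+1) (y^s z)^s = x^(s+1) y^(s^2) z^s are the multiples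
  by z and by y of the one monomial x^(s+1) y^(s^2-1) z^s. So y and z carry this monomial into the
  power s + 1, and it is the origin of the socle; with at most s factors there is no room for this.
  The additivity has a similar source. At suitable exponents of y_j and z_j, the factor j demands
  one more x than it would after multiplication by y_j (or by z_j, if that is still present). A
  monomial whose x-exponent misses the total demand by exactly one lies outside the power, yet every
  remaining variable closes the gap: x by supplying the missing unit, the others by lowering one
  demand. The separate factor x keeps the ideal proper also when there are no factors J.\<close>

definition ring_on :: "'r::comm_ring_1 set \<Rightarrow> 'r ring" where
  "ring_on S = \<lparr>carrier = S, mult = (*), one = 1, zero = 0, add = (+)\<rparr>"

definition coset :: "'r::comm_ring_1 set \<Rightarrow> 'r \<Rightarrow> 'r set" where
  "coset Q p = (\<lambda>q. q + p) ` Q"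

text \<open>The polynomials in n variables form a subset of one type. Ring computations are
  therefore left to the type class, and only membership in S has to be tracked.\<close>

locale unital_subring =
  fixes S :: "'r::comm_ring_1 set"
  assumes zero_mem [simp]: "0 \<in> S"
    and one_mem [simp]: "1 \<in> S"
    and add_mem [simp]: "\<And>p q. p \<in> S \<Longrightarrow> q \<in> S \<Longrightarrow> p + q \<in> S"
    and uminus_mem [simp]: "\<And>p. p \<in> S \<Longrightarrow> - p \<in> S"
    and mult_mem [simp]: "\<And>p q. p \<in> S \<Longrightarrow> q \<in> S \<Longrightarrow> p * q \<in> S"
begin

abbreviation "R \<equiv> ring_on S"

lemma diff_mem [simp]: "p \<in> S \<Longrightarrow> q \<in> S \<Longrightarrow> p - q \<in> S"
  using add_mem[of p "- q"] by simp

lemma sum_mem: "(\<And>i. i \<in> A \<Longrightarrow> f i \<in> S) \<Longrightarrow> sum f A \<in> S"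
  by (induction A rule: infinite_finite_induct) auto

lemma cring_ring_on: "cring R"
proof (rule cringI)
  have "\<exists>y\<in>S. y + x = 0" if "x \<in> S" for x
    using that by (intro bexI[of _ "- x"]) auto
  then show "abelian_group R"
    by (intro abelian_groupI) (auto simp: ring_on_def algebra_simps)
  show "Group.comm_monoid R"
    by (intro comm_monoidI) (auto simp: ring_on_def algebra_simps)
qed (auto simp: ring_on_def algebra_simps)

sublocale R: cring R
  by (rule cring_ring_on)

lemma R_sel [simp]:
  "carrier R = S" "mult R = (*)" "one R = 1" "zero R = 0" "add R = (+)"
  by (simp_all add: ring_on_def)

lemma a_inv_R: "p \<in> S \<Longrightarrow> \<ominus>\<^bsub>R\<^esub> p = - p"
  by (rule R.minus_equality) auto

definition is_ideal :: "'r set \<Rightarrow> bool" where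
  "is_ideal L \<longleftrightarrow> L \<subseteq> S \<and> 0 \<in> L \<and> (\<forall>p\<in>L. \<forall>q\<in>L. p + q \<in> L) \<and> (\<forall>s\<in>S. \<forall>p\<in>L. s * p \<in> L)"

lemma ideal_iff: "ideal L R \<longleftrightarrow> is_ideal L"
proof
  assume "ideal L R"
  then interpret ideal L R .
  show "is_ideal L"
    using a_subset I_l_closed a_closed zero_closed unfolding is_ideal_def by auto
next
  assume L: "is_ideal L"
  have neg: "- p \<in> L" if "p \<in> L" for p
  proof -
    have "(- 1) * p \<in> L"
      using L that uminus_mem[OF one_mem] unfolding is_ideal_def by blast
    then show ?thesis by simp
  qed
  show "ideal L R"
  proof (rule idealI[OF R.ring_axioms])
    show "subgroup L (add_monoid R)"
      using L neg unfolding is_ideal_def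
      by (intro R.add.subgroupI)
        (auto simp: a_inv_R subset_iff simp flip: a_inv_def)
    fix p s assume "p \<in> L" "s \<in> carrier R"
    then show "s \<otimes>\<^bsub>R\<^esub> p \<in> L" "p \<otimes>\<^bsub>R\<^esub> s \<in> L"
      using L by (auto simp: is_ideal_def mult.commute[of p s])
  qed
qed

context
  fixes L assumes L: "is_ideal L"
begin

lemma ideal_sub: "p \<in> L \<Longrightarrow> p \<in> S" and ideal_zero: "0 \<in> L"
  and ideal_add: "p \<in> L \<Longrightarrow> q \<in> L \<Longrightarrow> p + q \<in> L"
  and ideal_mult: "s \<in> S \<Longrightarrow> p \<in> L \<Longrightarrow> s * p \<in> L"
  using L by (auto simp: is_ideal_def)

lemma ideal_mult_right: "s \<in> S \<Longrightarrow> p \<in> L \<Longrightarrow> p * s \<in> L"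
  by (metis ideal_mult mult.commute)

lemma ideal_neg: "p \<in> L \<Longrightarrow> - p \<in> L"
  using ideal_mult[of "- 1" p] by simp

lemma ideal_diff: "p \<in> L \<Longrightarrow> q \<in> L \<Longrightarrow> p - q \<in> L"
  using ideal_add[of p "- q"] ideal_neg[of q] by simp

lemma ideal_sum: "(\<And>i. i \<in> A \<Longrightarrow> f i \<in> L) \<Longrightarrow> sum f A \<in> L"
  by (induction A rule: infinite_finite_induct) (auto simp: ideal_zero ideal_add)

lemma coset_eq_iff: "coset L p = coset L p' \<longleftrightarrow> p - p' \<in> L"
proof
  assume "coset L p = coset L p'"
  moreover have "p \<in> coset L p"
    unfolding coset_def by (rule image_eqI[of _ _ 0]) (auto simp: ideal_zero)
  ultimately show "p - p' \<in> L"
    by (auto simp: coset_def)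
next
  assume *: "p - p' \<in> L"
  have "q + p \<in> coset L p'" if "q \<in> L" for q
    unfolding coset_def
    by (rule image_eqI[of _ _ "q + (p - p')"]) (use * that in \<open>auto simp: ideal_add\<close>)
  moreover have "q + p' \<in> coset L p" if "q \<in> L" for q
    unfolding coset_def
    by (rule image_eqI[of _ _ "q - (p - p')"]) (use * that in \<open>auto simp: ideal_diff\<close>)
  ultimately show "coset L p = coset L p'"
    unfolding coset_def by blast
qed

lemma coset_0: "coset L 0 = L"
  by (simp add: coset_def)

lemma coset_self: "p \<in> coset L p"
  using coset_def[of L p] ideal_zero by (auto intro: image_eqI[of _ _ 0])

end

section \<open>Adjoining elements to ideals, and regular sequences\<close>

definition adjoin :: "'r set \<Rightarrow> 'r \<Rightarrow> 'r set" where
  "adjoin L y = {l + y * s | l s. l \<in> L \<and> s \<in> S}"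

lemma is_ideal_adjoin:
  assumes L: "is_ideal L" and y: "y \<in> S"
  shows "is_ideal (adjoin L y)"
  unfolding is_ideal_def
proof (intro conjI ballI subsetI)
  fix p assume "p \<in> adjoin L y"
  then show "p \<in> S"
    using y ideal_sub[OF L] unfolding adjoin_def by auto
next
  have "0 = 0 + y * 0" by simp
  then show "0 \<in> adjoin L y"
    using ideal_zero[OF L] zero_mem unfolding adjoin_def by blast
next
  fix p q assume "p \<in> adjoin L y" "q \<in> adjoin L y"
  then obtain l s l' s' where "p = l + y * s" "q = l' + y * s'" "l \<in> L" "s \<in> S" "l' \<in> L" "s' \<in> S"
    unfolding adjoin_def by auto
  moreover from this have "p + q = (l + l') + y * (s + s')"
    by (simp add: algebra_simps)
  ultimately show "p + q \<in> adjoin L y"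
    using ideal_add[OF L] add_mem unfolding adjoin_def by blast
next
  fix r p assume "p \<in> adjoin L y" and r: "r \<in> S"
  then obtain l s where "p = l + y * s" "l \<in> L" "s \<in> S"
    unfolding adjoin_def by auto
  moreover from this have "r * p = r * l + y * (r * s)"
    by (simp add: algebra_simps)
  ultimately show "r * p \<in> adjoin L y"
    using ideal_mult[OF L] r mult_mem unfolding adjoin_def by blast
qed

lemma adjoin_superset: "L \<subseteq> adjoin L y"
proof
  fix l assume "l \<in> L"
  moreover have "l = l + y * 0" by simp
  ultimately show "l \<in> adjoin L y"
    using zero_mem unfolding adjoin_def by blast
qed

lemma adjoin_mem: "is_ideal L \<Longrightarrow> y \<in> adjoin L y"
proof -
  assume "is_ideal L"
  moreover have "y = 0 + y * 1" by simp
  ultimately show ?thesis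
    using ideal_zero one_mem unfolding adjoin_def by blast
qed

lemma adjoin_least: "is_ideal K \<Longrightarrow> L \<subseteq> K \<Longrightarrow> y \<in> K \<Longrightarrow> adjoin L y \<subseteq> K"
  unfolding adjoin_def using ideal_add ideal_mult_right by blast

fun adjoins :: "'r set \<Rightarrow> 'r list \<Rightarrow> 'r set" where
  "adjoins L [] = L"
| "adjoins L (y # ys) = adjoins (adjoin L y) ys"

lemma is_ideal_adjoins: "is_ideal L \<Longrightarrow> set ys \<subseteq> S \<Longrightarrow> is_ideal (adjoins L ys)"
  by (induction ys arbitrary: L) (auto simp: is_ideal_adjoin)

lemma adjoins_superset: "L \<subseteq> adjoins L ys"
  by (induction ys arbitrary: L) (use adjoin_superset in \<open>auto, blast\<close>)

lemma adjoins_mem: "is_ideal L \<Longrightarrow> set ys \<subseteq> S \<Longrightarrow> set ys \<subseteq> adjoins L ys"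
proof (induction ys arbitrary: L)
  case (Cons y ys)
  then have "y \<in> adjoins (adjoin L y) ys"
    using adjoin_mem adjoins_superset by blast
  then show ?case using Cons by (simp add: is_ideal_adjoin)
qed simp

lemma adjoins_least: "is_ideal K \<Longrightarrow> L \<subseteq> K \<Longrightarrow> set ys \<subseteq> K \<Longrightarrow> adjoins L ys \<subseteq> K"
  by (induction ys arbitrary: L) (auto simp: adjoin_least)

lemma adjoins_snoc: "adjoins L (ys @ [y]) = adjoin (adjoins L ys) y"
  by (induction ys arbitrary: L) auto

definition regular_on :: "'r set \<Rightarrow> 'r \<Rightarrow> bool" where
  "regular_on L y \<longleftrightarrow> (\<forall>p\<in>S. y * p \<in> L \<longrightarrow> p \<in> L)"

text \<open>Regular sequences on S/L with properness split off. This makes the notion recursive in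
  the ideal, with \<open>adjoin L y\<close> in place of L for the remaining elements; properness
  returns as \<open>adjoins Q ys \<noteq> S\<close>.\<close>

fun weakly_regular :: "'r set \<Rightarrow> 'r list \<Rightarrow> bool" where
  "weakly_regular L [] \<longleftrightarrow> True"
| "weakly_regular L (y # ys) \<longleftrightarrow> regular_on L y \<and> weakly_regular (adjoin L y) ys"

lemma weakly_regular_iff:
  "weakly_regular L ys \<longleftrightarrow> (\<forall>i<length ys. regular_on (adjoins L (take i ys)) (ys ! i))"
proof (induction ys arbitrary: L)
  case (Cons y ys)
  show ?case
    unfolding weakly_regular.simps Cons.IH
    by (auto simp: less_Suc_eq_0_disj all_conj_distrib)
qed simp

lemma weakly_regular_append:
  "weakly_regular L (xs @ ys) \<longleftrightarrow> weakly_regular L xs \<and> weakly_regular (adjoins L xs) ys"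
  by (induction xs arbitrary: L) auto

section \<open>The module S/Q through ideals of S that contain Q\<close>

context
  fixes Q assumes Q: "is_ideal Q"
begin

abbreviation "M \<equiv> quot_module (regular_module R) Q"

lemma r_coset_regular: "Q +>\<^bsub>regular_module R\<^esub> p = coset Q p"
  by (auto simp: a_r_coset_def r_coset_def regular_module_def coset_def)

lemma carrier_M: "carrier M = coset Q ` S"
  by (auto simp: quot_module_def A_RCOSETS_def RCOSETS_def regular_module_def r_coset_def coset_def)

lemma zero_M: "zero M = coset Q 0"
  by (simp add: quot_module_def coset_0[OF Q])

lemma add_M: "coset Q p \<oplus>\<^bsub>M\<^esub> coset Q p' = coset Q (p + p')"
proof -
  have "coset Q p \<oplus>\<^bsub>M\<^esub> coset Q p' = (\<Union>q\<in>Q. \<Union>q'\<in>Q. {(q + p) + (q' + p')})"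
    by (auto simp: quot_module_def set_add_def set_mult_def regular_module_def coset_def)
  also have "\<dots> = coset Q (p + p')"
  proof -
    have "(q + p) + (q' + p') \<in> coset Q (p + p')" if "q \<in> Q" "q' \<in> Q" for q q'
      unfolding coset_def
      by (rule image_eqI[of _ _ "q + q'"]) (use that in \<open>auto simp: ideal_add[OF Q]\<close>)
    moreover have "q + (p + p') \<in> (\<Union>q\<in>Q. \<Union>q'\<in>Q. {(q + p) + (q' + p')})" if "q \<in> Q" for q
      using that ideal_zero[OF Q]
      by (intro UN_I[of q] UN_I[of 0]) (auto simp: algebra_simps)
    ultimately show ?thesis
      unfolding coset_def by blast
  qed
  finally show ?thesis .
qed

lemma smult_M:
  assumes "r \<in> S" "p \<in> S"
  shows "r \<odot>\<^bsub>M\<^esub> coset Q p = coset Q (r * p)"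
proof -
  have "r \<odot>\<^bsub>M\<^esub> coset Q p = (\<Union>x\<in>coset Q p. coset Q (r * x))"
    by (simp add: quot_module_def r_coset_regular) (simp add: regular_module_def)
  moreover have "coset Q (r * x) = coset Q (r * p)" if "x \<in> coset Q p" for x
    using that ideal_mult[OF Q] assms
    by (auto simp: coset_def[of Q p] coset_eq_iff[OF Q] simp flip: right_diff_distrib)
  ultimately show ?thesis
    using coset_self[OF Q, of p] by blast
qed

lemma abelian_group_M: "abelian_group M"
proof (rule abelian_groupI)
  show "\<exists>y\<in>carrier M. y \<oplus>\<^bsub>M\<^esub> x = \<zero>\<^bsub>M\<^esub>" if "x \<in> carrier M" for x
  proof -
    from that obtain p where "p \<in> S" "x = coset Q p"
      by (auto simp: carrier_M)
    then show ?thesis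
      by (intro bexI[of _ "coset Q (- p)"]) (auto simp: add_M zero_M carrier_M)
  qed
qed (auto simp: carrier_M add_M zero_M algebra_simps)

lemma a_inv_M: "p \<in> S \<Longrightarrow> \<ominus>\<^bsub>M\<^esub> coset Q p = coset Q (- p)"
  by (rule abelian_group.minus_equality[OF abelian_group_M])
    (auto simp: carrier_M add_M zero_M)

lemma submodule_coset_image:
  assumes L: "is_ideal L"
  shows "submodule (coset Q ` L) R M"
proof (intro submodule.intro submodule_axioms.intro)
  interpret M: abelian_group M by (rule abelian_group_M)
  show "subgroup (coset Q ` L) (add_monoid M)"
  proof (rule M.add.subgroupI)
    show "coset Q ` L \<subseteq> carrier M"
      using ideal_sub[OF L] by (auto simp: carrier_M)
    show "coset Q ` L \<noteq> {}" using ideal_zero[OF L] by auto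
    fix X assume "X \<in> coset Q ` L"
    then obtain p where p: "p \<in> L" "X = coset Q p" by auto
    then have "\<ominus>\<^bsub>M\<^esub> X = coset Q (- p)"
      using ideal_sub[OF L] a_inv_M by auto
    then show "\<ominus>\<^bsub>M\<^esub> X \<in> coset Q ` L"
      using p ideal_neg[OF L] by auto
    fix Y assume "Y \<in> coset Q ` L"
    with \<open>X \<in> coset Q ` L\<close> show "X \<oplus>\<^bsub>M\<^esub> Y \<in> coset Q ` L"
      using ideal_add[OF L] by (auto simp: add_M)
  qed
qed (use L ideal_mult[OF L] ideal_sub[OF L] in \<open>auto simp: smult_M\<close>)

lemma ideal_of_submodule:
  assumes N: "submodule N R M"
  shows "is_ideal {p \<in> S. coset Q p \<in> N}" and "Q \<subseteq> {p \<in> S. coset Q p \<in> N}"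
proof -
  interpret submodule N R M by (rule N)
  have z: "coset Q 0 \<in> N"
    using one_closed by (simp add: zero_M)
  show "is_ideal {p \<in> S. coset Q p \<in> N}"
    unfolding is_ideal_def
  proof (intro conjI ballI)
    show "0 \<in> {p \<in> S. coset Q p \<in> N}"
      using z by simp
  next
    fix p q assume "p \<in> {p \<in> S. coset Q p \<in> N}" "q \<in> {p \<in> S. coset Q p \<in> N}"
    then show "p + q \<in> {p \<in> S. coset Q p \<in> N}"
      using m_closed[of "coset Q p" "coset Q q"] by (auto simp: add_M)
  next
    fix s p assume "s \<in> S" "p \<in> {p \<in> S. coset Q p \<in> N}"
    then show "s * p \<in> {p \<in> S. coset Q p \<in> N}"
      using smult_closed[of s "coset Q p"] by (auto simp: smult_M)
  qed auto
  have "coset Q q = coset Q 0" if "q \<in> Q" for q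
    using that by (simp add: coset_eq_iff[OF Q])
  then show "Q \<subseteq> {p \<in> S. coset Q p \<in> N}"
    using z ideal_sub[OF Q] by auto
qed

lemma set_smult_le:
  assumes L: "is_ideal L" and A: "A \<subseteq> L"
  shows "set_smult R A M \<subseteq> coset Q ` L"
proof -
  have "{r \<odot>\<^bsub>M\<^esub> m | r m. r \<in> A \<and> m \<in> carrier M} \<subseteq> coset Q ` L"
    using A ideal_sub[OF L] ideal_mult_right[OF L] by (auto simp: carrier_M smult_M subset_iff)
  then show ?thesis
    using submodule_coset_image[OF L] unfolding set_smult_def by blast
qed

text \<open>A submodule of S/Q pulls back to an ideal that contains Q. If it contains the products y
  m, then m = 1 puts each y of ys into this ideal, and with them all of
  \<open>adjoins Q ys\<close>.\<close>

lemma set_smult_eq: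
  assumes ys: "set ys \<subseteq> S"
  shows "set_smult R (set ys) M = coset Q ` adjoins Q ys"
proof
  show "set_smult R (set ys) M \<subseteq> coset Q ` adjoins Q ys"
    by (intro set_smult_le is_ideal_adjoins adjoins_mem Q ys)
  show "coset Q ` adjoins Q ys \<subseteq> set_smult R (set ys) M"
    unfolding set_smult_def
  proof (rule Inter_greatest, clarify)
    fix N p assume N: "submodule N R M"
      and gen: "{r \<odot>\<^bsub>M\<^esub> m | r m. r \<in> set ys \<and> m \<in> carrier M} \<subseteq> N"
      and p: "p \<in> adjoins Q ys"
    have "coset Q y \<in> N" if "y \<in> set ys" for y
    proof -
      have "y \<odot>\<^bsub>M\<^esub> coset Q 1 \<in> N"
        using gen that one_mem unfolding carrier_M by blast
      then show ?thesis
        using that ys by (auto simp: smult_M subset_iff)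
    qed
    then have "adjoins Q ys \<subseteq> {p \<in> S. coset Q p \<in> N}"
      using ideal_of_submodule[OF N] ys by (intro adjoins_least) auto
    then show "coset Q p \<in> N" using p by auto
  qed
qed

text \<open>The isomorphism (S/Q)/(L/Q) = S/L on representatives: \<open>?c p\<close>, a set of
  cosets of Q, is the class of p in the iterated quotient, and it is zero exactly for p in
  L.\<close>

lemma regular_element_quot_iff:
  assumes L: "is_ideal L" and QL: "Q \<subseteq> L" and r: "r \<in> S"
  shows "regular_element R (quot_module M (coset Q ` L)) r \<longleftrightarrow> regular_on L r"
proof -
  let ?N = "coset Q ` L"
  let ?c = "\<lambda>p. coset Q ` coset L p"
  have rc: "?N +>\<^bsub>M\<^esub> coset Q p = ?c p" for p
    by (auto simp: a_r_coset_def r_coset_def add_M coset_def[of L] image_image)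
  have carr: "carrier (quot_module M ?N) = ?c ` S"
  proof -
    have "carrier (quot_module M ?N) = (\<lambda>X. ?N +>\<^bsub>M\<^esub> X) ` carrier M"
      by (auto simp: quot_module_def[of M] A_RCOSETS_def RCOSETS_def a_r_coset_def)
    then show ?thesis by (simp add: carrier_M image_image rc)
  qed
  have zero: "zero (quot_module M ?N) = ?N"
    by (simp add: quot_module_def[of M])
  have coset_le: "?c p = ?N \<longleftrightarrow> p \<in> L" for p
  proof
    assume "?c p = ?N"
    then have "coset Q p \<in> ?N"
      using coset_self[OF L, of p] by blast
    then obtain l where "l \<in> L" "p - l \<in> Q"
      by (auto simp: coset_eq_iff[OF Q])
    then show "p \<in> L"
      using ideal_add[OF L, of "p - l" l] QL by auto
  next
    assume "p \<in> L"
    then have "coset L p = L"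
      using coset_eq_iff[OF L, of p 0] coset_0[OF L] by simp
    then show "?c p = ?N" by simp
  qed
  have sm: "r \<odot>\<^bsub>quot_module M ?N\<^esub> ?c p = ?c (r * p)" if p: "p \<in> S" for p
  proof -
    have "r \<odot>\<^bsub>quot_module M ?N\<^esub> ?c p = (\<Union>x\<in>?c p. ?N +>\<^bsub>M\<^esub> (r \<odot>\<^bsub>M\<^esub> x))"
      by (simp add: quot_module_def[of M])
    moreover have "?N +>\<^bsub>M\<^esub> (r \<odot>\<^bsub>M\<^esub> x) = ?c (r * p)" if "x \<in> ?c p" for x
    proof -
      from that obtain l where l: "l \<in> L" "x = coset Q (l + p)"
        by (auto simp: coset_def[of L])
      have "coset L (r * (l + p)) = coset L (r * p)"
        using l r ideal_mult[OF L] by (simp add: coset_eq_iff[OF L] flip: right_diff_distrib)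
      then show ?thesis
        using l r p ideal_sub[OF L] by (simp add: smult_M rc)
    qed
    moreover have "?c p \<noteq> {}"
      using coset_self[OF L] by auto
    ultimately show ?thesis by auto
  qed
  show ?thesis
    unfolding regular_element_def regular_on_def carr zero R_sel
    using r by (auto simp: sm coset_le)
qed

lemma regular_sequence_quotient_iff:
  assumes ys: "set ys \<subseteq> S"
  shows "regular_sequence R M ys \<longleftrightarrow> weakly_regular Q ys \<and> adjoins Q ys \<noteq> S"
proof -
  have take: "set (take i ys) \<subseteq> S" for i
    using ys set_take_subset by fast
  have "coset Q ` L = carrier M \<longleftrightarrow> L = S" if L: "is_ideal L" "Q \<subseteq> L" for L
  proof
    assume eq: "coset Q ` L = carrier M"
    have "p \<in> L" if "p \<in> S" for p
    proof -
      have "coset Q p \<in> coset Q ` L"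
        using eq that unfolding carrier_M by simp
      then obtain l where "l \<in> L" "p - l \<in> Q"
        by (auto simp: coset_eq_iff[OF Q])
      then show ?thesis
        using ideal_add[OF L(1), of "p - l" l] L(2) by auto
    qed
    then show "L = S" using ideal_sub[OF L(1)] by auto
  qed (simp add: carrier_M)
  moreover have "is_ideal (adjoins Q ys)" "Q \<subseteq> adjoins Q ys"
    using is_ideal_adjoins Q ys adjoins_superset by blast+
  moreover have "regular_element R (quot_module M (set_smult R (set (take i ys)) M)) (ys ! i)
      \<longleftrightarrow> regular_on (adjoins Q (take i ys)) (ys ! i)" if "i < length ys" for i
    unfolding set_smult_eq[OF take]
    using that ys nth_mem by (intro regular_element_quot_iff is_ideal_adjoins Q take adjoins_superset) auto
  ultimately show ?thesis
    unfolding regular_sequence_def weakly_regular_iff set_smult_eq[OF ys] by auto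
qed

end

end

section \<open>Koszul cohomology and depth\<close>

text \<open>Index the basis of the exterior algebra by finite sets B of numbers. This is the sign
  that appears when e_j is moved to its place among the e_i with i in B.\<close>

definition ksign :: "nat \<Rightarrow> nat set \<Rightarrow> 'r::comm_ring_1" where
  "ksign j B = (- 1) ^ card {i \<in> B. i < j}"

lemma ksign_square: "ksign j B * ksign j B = (1 :: 'r::comm_ring_1)"
  by (simp add: ksign_def flip: power_add)

lemma ksign_remove:
  assumes "finite B" "j \<in> B"
  shows "ksign i (B - {j}) = (if j < i then - ksign i B else ksign i B)"
proof (cases "j < i")
  case True
  have "{k \<in> B. k < i} = insert j {k \<in> B - {j}. k < i}"
    using assms True by auto
  then have "card {k \<in> B. k < i} = Suc (card {k \<in> B - {j}. k < i})"
    using assms by simp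
  then show ?thesis using True by (simp add: ksign_def)
next
  case False
  then have "{k \<in> B - {j}. k < i} = {k \<in> B. k < i}" by auto
  then show ?thesis using False by (simp add: ksign_def)
qed

lemma ksign_insert:
  assumes "finite B" "j \<notin> B"
  shows "ksign i (insert j B) = (if j < i then - ksign i B else ksign i B)"
proof -
  have "insert j B - {j} = B" using assms by auto
  then have "ksign i B = (if j < i then - ksign i (insert j B) else (ksign i (insert j B) :: 'a))"
    using ksign_remove[of "insert j B" j i] assms by simp
  then show ?thesis by simp
qed

text \<open>The Koszul differential, in all degrees at once: exterior multiplication of the element
  with coefficients c by the sum of the x_j e_j, read off at e_B.\<close>

definition kdiff :: "(nat \<Rightarrow> 'r) \<Rightarrow> (nat set \<Rightarrow> 'r) \<Rightarrow> nat set \<Rightarrow> 'r::comm_ring_1" where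
  "kdiff x c B = (\<Sum>j\<in>B. ksign j B * x j * c (B - {j}))"

text \<open>Removing i and j from C in the two possible orders gives the same term with opposite
  signs.\<close>

lemma kdiff_kdiff:
  assumes C: "finite C"
  shows "kdiff x (kdiff x c) C = (0 :: 'r::comm_ring_1)"
proof -
  define T where "T j i = ksign j C * x j * (ksign i (C - {j}) * x i * c (C - {j} - {i}))" for j i
  have anti: "T j i = - T i j" if "i \<in> C" "j \<in> C" "i < j" for i j
  proof -
    have "C - {j} - {i} = C - {i} - {j}" by auto
    then show ?thesis
      using that C by (simp add: T_def ksign_remove algebra_simps)
  qed
  have "kdiff x (kdiff x c) C = (\<Sum>j\<in>C. \<Sum>i\<in>C - {j}. T j i)"
    by (simp add: kdiff_def T_def sum_distrib_left)
  also have "\<dots> = (\<Sum>j\<in>C. \<Sum>i\<in>C. (if i < j then T j i else 0) + (if j < i then T j i else 0))"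
  proof (rule sum.cong[OF refl])
    fix j assume "j \<in> C"
    have "(\<Sum>i\<in>C. (if i < j then T j i else 0) + (if j < i then T j i else 0)) =
        (\<Sum>i\<in>C - {j}. (if i < j then T j i else 0) + (if j < i then T j i else 0))"
      by (rule sum.mono_neutral_right) (use C in auto)
    also have "\<dots> = (\<Sum>i\<in>C - {j}. T j i)"
      by (rule sum.cong) auto
    finally show "(\<Sum>i\<in>C - {j}. T j i) =
        (\<Sum>i\<in>C. (if i < j then T j i else 0) + (if j < i then T j i else 0))" ..
  qed
  also have "\<dots> = (\<Sum>j\<in>C. \<Sum>i\<in>C. if i < j then T j i else 0) +
      (\<Sum>j\<in>C. \<Sum>i\<in>C. if j < i then T j i else 0)"
    by (simp add: sum.distrib)
  also have "(\<Sum>j\<in>C. \<Sum>i\<in>C. if j < i then T j i else 0) =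
      (\<Sum>j\<in>C. \<Sum>i\<in>C. if i < j then T i j else 0)"
    by (rule sum.swap)
  also have "(\<Sum>j\<in>C. \<Sum>i\<in>C. if i < j then T j i else 0) + \<dots> =
      (\<Sum>j\<in>C. \<Sum>i\<in>C. (if i < j then T j i + T i j else 0))"
    unfolding sum.distrib[symmetric] by (intro sum.cong refl) auto
  also have "\<dots> = 0"
    using anti by (intro sum.neutral ballI) auto
  finally show ?thesis .
qed

lemma kdiff_diff: "kdiff x (\<lambda>A. c A - c' A) B = kdiff x c B - kdiff x c' B"
  by (simp add: kdiff_def sum_subtractf algebra_simps)

lemma kdiff_mult: "kdiff x (\<lambda>A. y * c A) B = y * kdiff x c B"
  by (simp add: kdiff_def sum_distrib_left algebra_simps)

text \<open>Contraction with the linear form e_j \<mapsto> a_j. The number n bounds the indices that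
  can be added to A.\<close>

definition kcontract :: "nat \<Rightarrow> (nat \<Rightarrow> 'r) \<Rightarrow> (nat set \<Rightarrow> 'r) \<Rightarrow> nat set \<Rightarrow> 'r::comm_ring_1" where
  "kcontract n a c A = (\<Sum>j\<in>{..<n} - A. ksign j A * a j * c (insert j A))"

text \<open>The contraction is a homotopy between zero and multiplication by y = \<Sum> a_j x_j.
  Consequently every element of the ideal of the x_j annihilates Koszul cohomology.\<close>

lemma kdiff_kcontract:
  fixes c :: "nat set \<Rightarrow> 'r::comm_ring_1"
  assumes B: "B \<subseteq> {..<n}"
  shows "kdiff x (kcontract n a c) B + kcontract n a (kdiff x c) B = (\<Sum>j<n. a j * x j) * c B"
proof -
  have fin: "finite B" using B finite_subset by blast
  \<comment> \<open>The mixed terms, where k leaves B and j enters. They occur in both sums with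
    opposite signs; the terms that leave B unchanged make up the right-hand side.\<close>
  define P where "P k j = ksign k B * x k * (ksign j (B - {k}) * a j * c (insert j (B - {k})))" for k j
  have "kdiff x (kcontract n a c) B = (\<Sum>k\<in>B. a k * x k * c B + (\<Sum>j\<in>{..<n} - B. P k j))"
    unfolding kdiff_def
  proof (rule sum.cong[OF refl])
    fix k assume k: "k \<in> B"
    have "{..<n} - (B - {k}) = insert k ({..<n} - B)"
      using k B by auto
    then have "kcontract n a c (B - {k}) = ksign k (B - {k}) * a k * c (insert k (B - {k}))
        + (\<Sum>j\<in>{..<n} - B. ksign j (B - {k}) * a j * c (insert j (B - {k})))"
      using k by (simp add: kcontract_def)
    moreover have "insert k (B - {k}) = B" using k by auto
    moreover have "ksign k B * (x k * (ksign k B * (a k * c B))) = a k * x k * c B"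
    proof -
      have "ksign k B * (x k * (ksign k B * (a k * c B))) = (ksign k B * ksign k B) * (a k * x k * c B)"
        by (simp only: ac_simps)
      then show ?thesis by (simp add: ksign_square)
    qed
    ultimately show "ksign k B * x k * kcontract n a c (B - {k})
        = a k * x k * c B + (\<Sum>j\<in>{..<n} - B. P k j)"
      using fin k by (simp add: P_def ksign_remove sum_distrib_left distrib_left mult.assoc)
  qed
  moreover have "kcontract n a (kdiff x c) B = (\<Sum>j\<in>{..<n} - B. a j * x j * c B - (\<Sum>k\<in>B. P k j))"
    unfolding kcontract_def
  proof (rule sum.cong[OF refl])
    fix j assume "j \<in> {..<n} - B"
    then have j: "j \<notin> B" by simp
    have "ksign j B * a j * (ksign k (insert j B) * x k * c (insert j B - {k})) = - P k j"
      if k: "k \<in> B" for k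
    proof -
      have "insert j B - {k} = insert j (B - {k})" using j k by auto
      moreover have "ksign k (insert j B) = (if j < k then - ksign k B else (ksign k B :: 'r))"
        using ksign_insert fin j by blast
      moreover have "ksign j (B - {k}) = (if k < j then - ksign j B else (ksign j B :: 'r))"
        using ksign_remove fin k by blast
      moreover have "j \<noteq> k" using j k by auto
      ultimately show ?thesis
        by (simp add: P_def ac_simps)
    qed
    then have "(\<Sum>k\<in>B. ksign j B * a j * (ksign k (insert j B) * x k * c (insert j B - {k})))
        = - (\<Sum>k\<in>B. P k j)"
      by (simp add: sum_negf)
    moreover have "insert j B - {j} = B" using j by auto
    moreover have "ksign j B * (a j * (ksign j B * (x j * c B))) = a j * x j * c B"
    proof -
      have "ksign j B * (a j * (ksign j B * (x j * c B))) = (ksign j B * ksign j B) * (a j * x j * c B)"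
        by (simp only: ac_simps)
      then show ?thesis by (simp add: ksign_square)
    qed
    ultimately show "ksign j B * a j * kdiff x c (insert j B) = a j * x j * c B - (\<Sum>k\<in>B. P k j)"
      using fin j by (simp add: kdiff_def ksign_insert distrib_left sum_distrib_left mult.assoc)
  qed
  moreover have "(\<Sum>k\<in>B. \<Sum>j\<in>{..<n} - B. P k j) = (\<Sum>j\<in>{..<n} - B. \<Sum>k\<in>B. P k j)"
    by (rule sum.swap)
  moreover have "(\<Sum>j<n. a j * x j) = (\<Sum>j\<in>B. a j * x j) + (\<Sum>j\<in>{..<n} - B. a j * x j)"
    using B by (metis add.commute finite_lessThan sum.subset_diff)
  ultimately show ?thesis
    by (simp add: sum.distrib sum_subtractf sum_distrib_right distrib_right)
qed

section \<open>Koszul cohomology with coefficients in S/L\<close>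

locale koszul = unital_subring S for S :: "'r::comm_ring_1 set" +
  fixes x :: "nat \<Rightarrow> 'r" and n :: nat
  assumes x_mem: "i < n \<Longrightarrow> x i \<in> S"
begin

lemma ksign_mem [simp]: "ksign j B \<in> S"
proof -
  have "(- 1) ^ m \<in> S" for m
    by (induction m) (auto simp del: mult_minus_left)
  then show ?thesis by (simp add: ksign_def)
qed

definition cochain :: "(nat set \<Rightarrow> 'r) \<Rightarrow> bool" where
  "cochain c \<longleftrightarrow> (\<forall>A. c A \<in> S)"

text \<open>Cochains of S/L are represented by S-valued functions on all sets; only the values on
  subsets of \<open>{..<n}\<close> of the right size count, and equations hold modulo L. In degree 0
  the empty sum \<open>kdiff x e {}\<close> vanishes, so being a coboundary means having the value
  at the empty set in L.\<close>

definition cocycle :: "nat \<Rightarrow> 'r set \<Rightarrow> (nat set \<Rightarrow> 'r) \<Rightarrow> bool" where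
  "cocycle i L c \<longleftrightarrow> cochain c \<and> (\<forall>B\<subseteq>{..<n}. card B = Suc i \<longrightarrow> kdiff x c B \<in> L)"

definition coboundary :: "nat \<Rightarrow> 'r set \<Rightarrow> (nat set \<Rightarrow> 'r) \<Rightarrow> bool" where
  "coboundary i L c \<longleftrightarrow>
    (\<exists>e. cochain e \<and> (\<forall>A\<subseteq>{..<n}. card A = i \<longrightarrow> c A - kdiff x e A \<in> L))"

definition nontrivial_cohomology :: "nat \<Rightarrow> 'r set \<Rightarrow> bool" where
  "nontrivial_cohomology i L \<longleftrightarrow> (\<exists>c. cocycle i L c \<and> \<not> coboundary i L c)"

definition var_ideal :: "'r set" where
  "var_ideal = {\<Sum>j<n. a j * x j | a. \<forall>j. a j \<in> S}"

lemma kdiff_mem: "cochain c \<Longrightarrow> B \<subseteq> {..<n} \<Longrightarrow> kdiff x c B \<in> S"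
  unfolding kdiff_def cochain_def by (intro sum_mem) (auto intro!: mult_mem x_mem)

text \<open>Multiplication by y gives the exact sequence 0 -> S/L -> S/L -> S/(L + yS) -> 0. Since y
  is a combination of the x_j, it annihilates H^i(S/L), so the connecting map from H^(i-1)(S/(L +
  yS)) to H^i(S/L) is onto. The contraction h of c is an explicit preimage of c.\<close>

lemma cohomology_descend:
  assumes L: "is_ideal L" and y: "y \<in> var_ideal" and reg: "regular_on L y"
    and H: "nontrivial_cohomology i L"
  shows "\<exists>m. i = Suc m \<and> nontrivial_cohomology m (adjoin L y)"
proof -
  obtain a where a: "\<And>j. a j \<in> S" and y_eq: "y = (\<Sum>j<n. a j * x j)"
    using y by (auto simp: var_ideal_def)
  have yS: "y \<in> S"
    unfolding y_eq by (intro sum_mem mult_mem a x_mem) simp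
  obtain c where c: "cochain c"
    and cc: "\<And>B. B \<subseteq> {..<n} \<Longrightarrow> card B = Suc i \<Longrightarrow> kdiff x c B \<in> L"
    and nb: "\<not> coboundary i L c"
    using H by (auto simp: nontrivial_cohomology_def cocycle_def)
  define h where "h = kcontract n a c"
  have h: "cochain h"
    using c a unfolding cochain_def h_def kcontract_def by (intro allI sum_mem mult_mem) auto
  have hom: "y * c B - kdiff x h B \<in> L" if B: "B \<subseteq> {..<n}" "card B = i" for B
  proof -
    have "y * c B - kdiff x h B = kcontract n a (kdiff x c) B"
      using kdiff_kcontract[OF B(1), of x a c] by (simp add: h_def y_eq algebra_simps)
    also have "\<dots> \<in> L"
      unfolding kcontract_def
    proof (rule ideal_sum[OF L])
      fix j assume j: "j \<in> {..<n} - B"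
      have "finite B" using B finite_subset by blast
      then have "kdiff x c (insert j B) \<in> L"
        using j B by (intro cc) auto
      then show "ksign j B * a j * kdiff x c (insert j B) \<in> L"
        using ideal_mult[OF L] a by simp
    qed
    finally show ?thesis .
  qed
  \<comment> \<open>As y is regular, it can be cancelled: c differs from every coboundary even after
    multiplication by y.\<close>
  have not_all: "\<not> (\<exists>e. cochain e \<and> (\<forall>A\<subseteq>{..<n}. card A = i \<longrightarrow> y * (c A - kdiff x e A) \<in> L))"
  proof
    assume "\<exists>e. cochain e \<and> (\<forall>A\<subseteq>{..<n}. card A = i \<longrightarrow> y * (c A - kdiff x e A) \<in> L)"
    then obtain e where e: "cochain e"
      "\<And>A. A \<subseteq> {..<n} \<Longrightarrow> card A = i \<Longrightarrow> y * (c A - kdiff x e A) \<in> L"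
      by auto
    have "c A - kdiff x e A \<in> L" if "A \<subseteq> {..<n}" "card A = i" for A
      using reg e(2)[OF that] c kdiff_mem[OF e(1) that(1)]
      by (auto simp: regular_on_def cochain_def)
    then show False
      using nb e(1) by (auto simp: coboundary_def)
  qed
  show ?thesis
  proof (cases i)
    \<comment> \<open>There is no lower degree: the differential of h is zero at the empty set, so
      \<open>hom\<close> puts y times the value of c there into L.\<close>
    case 0
    have "y * (c A - kdiff x (\<lambda>_. 0) A) \<in> L" if "A \<subseteq> {..<n}" "card A = i" for A
    proof -
      have "A = {}" using that 0 finite_subset by fastforce
      then show ?thesis using hom[of A] that by (simp add: kdiff_def)
    qed
    moreover have "cochain (\<lambda>_. 0)" by (simp add: cochain_def)
    ultimately show ?thesis using not_all by blast
  next
    case (Suc m)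
    have "cocycle m (adjoin L y) h"
      unfolding cocycle_def
    proof (intro conjI allI impI)
      fix B assume B: "B \<subseteq> {..<n}" "card B = Suc m"
      have "kdiff x h B = - (y * c B - kdiff x h B) + y * c B" by simp
      moreover have "- (y * c B - kdiff x h B) \<in> L"
        using hom[of B] B Suc ideal_neg[OF L] by blast
      moreover have "c B \<in> S" using c by (simp add: cochain_def)
      ultimately show "kdiff x h B \<in> adjoin L y"
        unfolding adjoin_def by blast
    qed (rule h)
    moreover have "\<not> coboundary m (adjoin L y) h"
    proof
      assume "coboundary m (adjoin L y) h"
      then obtain g where g: "cochain g"
        and hg: "\<And>A. A \<subseteq> {..<n} \<Longrightarrow> card A = m \<Longrightarrow> h A - kdiff x g A \<in> adjoin L y"
        by (auto simp: coboundary_def)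
      \<comment> \<open>The implication allows the default value 0 on irrelevant sets. So
        \<open>l\<close> and \<open>e\<close> become total functions into L and S, and
        \<open>e\<close> is a cochain.\<close>
      have "\<exists>l s. l \<in> L \<and> s \<in> S \<and> (A \<subseteq> {..<n} \<and> card A = m \<longrightarrow> h A - kdiff x g A = l + y * s)" for A
        using hg[of A] ideal_zero[OF L] zero_mem unfolding adjoin_def by blast
      then obtain l e where l: "\<And>A. l A \<in> L" and e: "\<And>A. e A \<in> S"
        and le: "\<And>A. A \<subseteq> {..<n} \<Longrightarrow> card A = m \<Longrightarrow> h A - kdiff x g A = l A + y * e A"
        by metis
      have "y * (c B - kdiff x e B) \<in> L" if B: "B \<subseteq> {..<n}" "card B = i" for B
      proof -
        have finB: "finite B" using B finite_subset by blast
        have "kdiff x h B = kdiff x (\<lambda>A. h A - kdiff x g A) B"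
          using kdiff_kdiff[OF finB, of x g] by (simp add: kdiff_diff)
        also have "\<dots> = (\<Sum>j\<in>B. ksign j B * x j * (l (B - {j}) + y * e (B - {j})))"
          unfolding kdiff_def
        proof (intro sum.cong refl)
          fix j assume "j \<in> B"
          then have "B - {j} \<subseteq> {..<n}" "card (B - {j}) = m"
            using B finB Suc by auto
          from le[OF this] show "ksign j B * x j * (h (B - {j}) - (\<Sum>k\<in>B - {j}. ksign k (B - {j}) * x k * g (B - {j} - {k}))) =
            ksign j B * x j * (l (B - {j}) + y * e (B - {j}))"
            by (simp add: kdiff_def)
        qed
        also have "\<dots> = kdiff x l B + y * kdiff x e B"
          by (simp add: kdiff_def distrib_left sum.distrib sum_distrib_left algebra_simps)
        finally have "y * (c B - kdiff x e B) = (y * c B - kdiff x h B) + kdiff x l B"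
          by (simp add: algebra_simps)
        moreover have "kdiff x l B \<in> L"
          unfolding kdiff_def
        proof (rule ideal_sum[OF L])
          fix j assume "j \<in> B"
          then show "ksign j B * x j * l (B - {j}) \<in> L"
            using B x_mem by (intro ideal_mult[OF L] mult_mem l) auto
        qed
        ultimately show ?thesis
          using hom[OF B] ideal_add[OF L] by simp
      qed
      then show False using not_all e by (auto simp: cochain_def)
    qed
    ultimately show ?thesis
      using Suc by (auto simp: nontrivial_cohomology_def)
  qed
qed

text \<open>Each element of the sequence lowers a degree with nonzero cohomology by one, and degrees
  cannot become negative.\<close>

lemma weakly_regular_length_le:
  assumes "is_ideal L" "set ys \<subseteq> var_ideal" "weakly_regular L ys" "nontrivial_cohomology i L"
  shows "length ys \<le> i"
  using assms
proof (induction ys arbitrary: L i)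
  case (Cons y ys)
  have "y \<in> S"
    using Cons.prems(2) by (auto simp: var_ideal_def intro!: sum_mem mult_mem x_mem)
  moreover obtain m where "i = Suc m" "nontrivial_cohomology m (adjoin L y)"
    using Cons.prems cohomology_descend by fastforce
  ultimately show ?case
    using Cons.IH[of "adjoin L y" m] Cons.prems by (auto simp: is_ideal_adjoin)
qed simp

text \<open>If H^i(S/L) = 0, the connecting map H^i(S/(L + yS)) -> H^(i+1)(S/L) is injective. It
  sends h to the c with dh = y c modulo L. If c were de modulo L, then h - y e would be a cocycle
  and hence a coboundary modulo L, so h would be a coboundary modulo L + yS.\<close>

lemma cohomology_ascend:
  assumes L: "is_ideal L" and y: "y \<in> S" and reg: "regular_on L y"
    and triv: "\<not> nontrivial_cohomology i L" and H: "nontrivial_cohomology i (adjoin L y)"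
  shows "nontrivial_cohomology (Suc i) L"
proof -
  obtain h where h: "cochain h"
    and hc: "\<And>B. B \<subseteq> {..<n} \<Longrightarrow> card B = Suc i \<Longrightarrow> kdiff x h B \<in> adjoin L y"
    and nb: "\<not> coboundary i (adjoin L y) h"
    using H by (auto simp: nontrivial_cohomology_def cocycle_def)
  have "\<exists>l s. l \<in> L \<and> s \<in> S \<and> (B \<subseteq> {..<n} \<and> card B = Suc i \<longrightarrow> kdiff x h B = l + y * s)" for B
    using hc[of B] ideal_zero[OF L] zero_mem unfolding adjoin_def by blast
  then obtain l c where l: "\<And>B. l B \<in> L" and c: "\<And>B. c B \<in> S"
    and lc: "\<And>B. B \<subseteq> {..<n} \<Longrightarrow> card B = Suc i \<Longrightarrow> kdiff x h B = l B + y * c B"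
    by metis
  have kl: "kdiff x l C \<in> L" if C: "C \<subseteq> {..<n}" for C
    unfolding kdiff_def
  proof (rule ideal_sum[OF L])
    fix j assume "j \<in> C"
    then show "ksign j C * x j * l (C - {j}) \<in> L"
      using C x_mem by (intro ideal_mult[OF L] mult_mem l) auto
  qed
  have cS: "cochain c" using c by (simp add: cochain_def)
  have "cocycle (Suc i) L c"
    unfolding cocycle_def
  proof (intro conjI allI impI)
    fix C assume C: "C \<subseteq> {..<n}" "card C = Suc (Suc i)"
    have finC: "finite C" using C finite_subset by blast
    have "0 = kdiff x (kdiff x h) C"
      using kdiff_kdiff[OF finC] by metis
    also have "\<dots> = (\<Sum>j\<in>C. ksign j C * x j * (l (C - {j}) + y * c (C - {j})))"
      unfolding kdiff_def[of x "kdiff x h"]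
    proof (intro sum.cong refl)
      fix j assume "j \<in> C"
      then have "C - {j} \<subseteq> {..<n}" "card (C - {j}) = Suc i"
        using C finC by auto
      from lc[OF this] show "ksign j C * x j * kdiff x h (C - {j}) =
          ksign j C * x j * (l (C - {j}) + y * c (C - {j}))" by simp
    qed
    also have "\<dots> = kdiff x l C + y * kdiff x c C"
      by (simp add: kdiff_def distrib_left sum.distrib sum_distrib_left algebra_simps)
    finally have "y * kdiff x c C = - kdiff x l C"
      by (simp add: eq_neg_iff_add_eq_0 add.commute)
    then have "y * kdiff x c C \<in> L"
      using kl[OF C(1)] ideal_neg[OF L] by simp
    then show "kdiff x c C \<in> L"
      using reg kdiff_mem[OF cS C(1)] by (simp add: regular_on_def)
  qed (rule cS)
  moreover have "\<not> coboundary (Suc i) L c"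
  proof
    assume "coboundary (Suc i) L c"
    then obtain e where e: "cochain e"
      and ce: "\<And>A. A \<subseteq> {..<n} \<Longrightarrow> card A = Suc i \<Longrightarrow> c A - kdiff x e A \<in> L"
      by (auto simp: coboundary_def)
    define h' where "h' A = h A - y * e A" for A
    have "cocycle i L h'"
      unfolding cocycle_def
    proof (intro conjI allI impI)
      show "cochain h'"
        using h e y by (auto simp: cochain_def h'_def)
      fix B assume B: "B \<subseteq> {..<n}" "card B = Suc i"
      have "kdiff x h' B = kdiff x h B - y * kdiff x e B"
        unfolding h'_def kdiff_diff kdiff_mult ..
      also have "\<dots> = l B + y * (c B - kdiff x e B)"
        using lc[OF B] by (simp add: algebra_simps)
      finally show "kdiff x h' B \<in> L"
        using ideal_add[OF L l] ideal_mult[OF L y ce[OF B]] by simp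
    qed
    then have "coboundary i L h'"
      using triv by (auto simp: nontrivial_cohomology_def)
    then obtain g where g: "cochain g"
      and hg: "\<And>A. A \<subseteq> {..<n} \<Longrightarrow> card A = i \<Longrightarrow> h' A - kdiff x g A \<in> L"
      by (auto simp: coboundary_def)
    have "h A - kdiff x g A \<in> adjoin L y" if "A \<subseteq> {..<n}" "card A = i" for A
    proof -
      have "h A - kdiff x g A = (h' A - kdiff x g A) + y * e A"
        by (simp add: h'_def)
      then show ?thesis
        using hg[OF that] e unfolding adjoin_def cochain_def by blast
    qed
    then show False using nb g by (auto simp: coboundary_def)
  qed
  ultimately show ?thesis by (auto simp: nontrivial_cohomology_def)
qed

text \<open>H^0 consists of the classes annihilated by all x_j, that is, of the socle of
  S/L.\<close>

lemma nontrivial_cohomology_socle: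
  assumes u: "u \<in> S" "u \<notin> L" and soc: "\<And>j. j < n \<Longrightarrow> x j * u \<in> L"
  shows "nontrivial_cohomology 0 L"
proof -
  have "kdiff x (\<lambda>_. u) B \<in> L" if B: "B \<subseteq> {..<n}" "card B = Suc 0" for B
  proof -
    obtain j where "B = {j}" using B(2) by (metis One_nat_def card_1_singletonE)
    moreover have "{i \<in> {j}. i < j} = {}" by auto
    then have "ksign j {j} = (1 :: 'r)"
      by (simp only: ksign_def card.empty power_0)
    ultimately show ?thesis using soc[of j] B(1) by (simp add: kdiff_def)
  qed
  moreover have "\<not> coboundary 0 L (\<lambda>_. u)"
    using u(2) by (auto simp: coboundary_def kdiff_def)
  ultimately show ?thesis
    using u(1) by (auto simp: nontrivial_cohomology_def cocycle_def cochain_def)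
qed

text \<open>Going back along the sequence, each element raises the degree by one. The vanishing that
  \<open>cohomology_ascend\<close> asks for holds because y # ys is a regular sequence longer than
  the degree \<open>length ys\<close>.\<close>

lemma nontrivial_cohomology_weakly_regular:
  assumes "is_ideal L" "set ys \<subseteq> var_ideal" "weakly_regular L ys"
    "nontrivial_cohomology 0 (adjoins L ys)"
  shows "nontrivial_cohomology (length ys) L"
  using assms
proof (induction ys arbitrary: L)
  case (Cons y ys)
  have y: "y \<in> S"
    using Cons.prems(2) by (auto simp: var_ideal_def intro!: sum_mem mult_mem x_mem)
  have "nontrivial_cohomology (length ys) (adjoin L y)"
    using Cons y by (intro Cons.IH) (auto simp: is_ideal_adjoin)
  moreover have "\<not> nontrivial_cohomology (length ys) L"
    using weakly_regular_length_le[OF Cons.prems(1-3)] by fastforce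
  ultimately show ?case
    using cohomology_ascend Cons.prems y by auto
qed simp

lemma is_ideal_var_ideal: "is_ideal var_ideal"
  unfolding is_ideal_def
proof (intro conjI ballI subsetI)
  fix p assume "p \<in> var_ideal"
  then show "p \<in> S"
    by (auto simp: var_ideal_def intro!: sum_mem mult_mem x_mem)
next
  have "0 = (\<Sum>j<n. 0 * x j)" by simp
  then show "0 \<in> var_ideal"
    unfolding var_ideal_def using zero_mem by (intro CollectI exI[of _ "\<lambda>_. 0"]) auto
next
  fix p q assume "p \<in> var_ideal" "q \<in> var_ideal"
  then obtain a b where "p = (\<Sum>j<n. a j * x j)" "q = (\<Sum>j<n. b j * x j)"
    "\<forall>j. a j \<in> S" "\<forall>j. b j \<in> S"
    by (auto simp: var_ideal_def)
  then show "p + q \<in> var_ideal"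
    unfolding var_ideal_def
    by (intro CollectI exI[of _ "\<lambda>j. a j + b j"]) (auto simp: distrib_right sum.distrib)
next
  fix s p assume "p \<in> var_ideal" "s \<in> S"
  then obtain a where "p = (\<Sum>j<n. a j * x j)" "\<forall>j. a j \<in> S"
    by (auto simp: var_ideal_def)
  then show "s * p \<in> var_ideal"
    unfolding var_ideal_def using \<open>s \<in> S\<close>
    by (intro CollectI exI[of _ "\<lambda>j. s * a j"]) (auto simp: sum_distrib_left mult.assoc)
qed

lemma var_ideal_eq_genideal: "var_ideal = genideal R (x ` {..<n})"
proof
  have "x i \<in> var_ideal" if "i < n" for i
  proof -
    have "(\<Sum>j<n. (if j = i then 1 else 0) * x j) = (\<Sum>j<n. if j = i then x j else 0)"
      by (rule sum.cong) auto
    also have "\<dots> = x i"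
      using that by simp
    finally show ?thesis
      unfolding var_ideal_def by (intro CollectI exI[of _ "\<lambda>j. if j = i then 1 else 0"]) auto
  qed
  then show "genideal R (x ` {..<n}) \<subseteq> var_ideal"
    using is_ideal_var_ideal unfolding genideal_def ideal_iff by blast
  show "var_ideal \<subseteq> genideal R (x ` {..<n})"
  proof
    fix p assume "p \<in> var_ideal"
    then obtain a where p: "p = (\<Sum>j<n. a j * x j)" and a: "\<And>j. a j \<in> S"
      by (auto simp: var_ideal_def)
    have "p \<in> K" if "is_ideal K" "x ` {..<n} \<subseteq> K" for K
      unfolding p using that a by (intro ideal_sum[OF that(1)] ideal_mult[OF that(1)]) auto
    then show "p \<in> genideal R (x ` {..<n})"
      by (auto simp: genideal_def ideal_iff)
  qed
qed

text \<open>The element u plays two parts: it shows that \<open>adjoins Q ys\<close> is proper, so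
  ys is a regular sequence, and as a socle element it yields cohomology of S/Q in degree
  \<open>length ys\<close>, which bounds every other regular sequence.\<close>

theorem depth_quotient_eq:
  assumes Q: "is_ideal Q" "Q \<subseteq> var_ideal" and proper: "1 \<notin> var_ideal"
    and ys: "set ys \<subseteq> var_ideal" "weakly_regular Q ys"
    and u: "u \<in> S" "u \<notin> adjoins Q ys" "\<And>j. j < n \<Longrightarrow> x j * u \<in> adjoins Q ys"
  shows "depth R var_ideal (quot_module (regular_module R) Q) = enat (length ys)"
proof -
  let ?M = "quot_module (regular_module R) Q"
  note J = is_ideal_var_ideal
  have J_sub: "var_ideal \<subseteq> S" using ideal_sub[OF J] by blast
  have ys_S: "set ys \<subseteq> S" using ys(1) J_sub by blast
  have "coset Q 1 \<notin> coset Q ` var_ideal"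
  proof
    assume "coset Q 1 \<in> coset Q ` var_ideal"
    then obtain l where "l \<in> var_ideal" "1 - l \<in> Q"
      by (auto simp: coset_eq_iff[OF Q(1)])
    then have "1 \<in> var_ideal"
      using ideal_add[OF J, of "1 - l" l] Q(2) by auto
    with proper show False ..
  qed
  then have "set_smult R var_ideal ?M \<noteq> carrier ?M"
    using set_smult_le[OF Q(1) J order_refl] one_mem unfolding carrier_M[OF Q(1)] by blast
  moreover have "Sup {enat (length rs) | rs. set rs \<subseteq> var_ideal \<and> regular_sequence R ?M rs} = enat (length ys)"
  proof (rule antisym)
    have "nontrivial_cohomology (length ys) Q"
      using nontrivial_cohomology_weakly_regular[OF Q(1) ys] nontrivial_cohomology_socle u by blast
    then have "length rs \<le> length ys" if "set rs \<subseteq> var_ideal" "regular_sequence R ?M rs" for rs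
      using that regular_sequence_quotient_iff[OF Q(1), of rs] weakly_regular_length_le[OF Q(1)] J_sub
      by blast
    then show "Sup {enat (length rs) | rs. set rs \<subseteq> var_ideal \<and> regular_sequence R ?M rs} \<le> enat (length ys)"
      by (intro Sup_least) auto
    have "regular_sequence R ?M ys"
      using regular_sequence_quotient_iff[OF Q(1) ys_S] ys u by blast
    then show "enat (length ys) \<le> Sup {enat (length rs) | rs. set rs \<subseteq> var_ideal \<and> regular_sequence R ?M rs}"
      using ys(1) by (intro Sup_upper) auto
  qed
  ultimately show ?thesis
    by (simp add: depth_def)
qed

end

section \<open>Polynomials with prescribed exponents\<close>

lemma exponents_zero [simp]: "0 \<in> exponents n"
  by (simp add: exponents_def)

lemma exponents_iff: "e \<in> exponents n \<longleftrightarrow> (\<forall>i\<ge>n. Poly_Mapping.lookup e i = 0)"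
  unfolding exponents_def mem_Collect_eq subset_iff in_keys_iff lessThan_iff by (meson not_le)

lemma exponents_add [simp]: "e + e' \<in> exponents n \<longleftrightarrow> e \<in> exponents n \<and> e' \<in> exponents n"
  by (auto simp: exponents_iff lookup_add)

lemma exponents_single [simp]: "i < n \<Longrightarrow> Poly_Mapping.single i m \<in> exponents n"
  by (auto simp: exponents_iff lookup_single when_def)

text \<open>The K-span of the monomials with exponents in F. It represents the polynomial ring,
  monomial ideals, and polynomial rings in a subset of the variables alike.\<close>

definition polys_on :: "(nat \<Rightarrow>\<^sub>0 nat) set \<Rightarrow> 'k::field mpoly set" where
  "polys_on F = {p. Poly_Mapping.keys p \<subseteq> F}"

lemma polys_on_zero [simp]: "0 \<in> polys_on F"
  by (simp add: polys_on_def)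

lemma polys_on_add: "p \<in> polys_on F \<Longrightarrow> q \<in> polys_on F \<Longrightarrow> p + q \<in> polys_on F"
  using keys_add[of p q] by (auto simp: polys_on_def)

lemma polys_on_uminus: "p \<in> polys_on F \<Longrightarrow> - p \<in> polys_on F"
  by (auto simp: polys_on_def in_keys_iff subset_iff)

lemma polys_on_diff: "p \<in> polys_on F \<Longrightarrow> q \<in> polys_on F \<Longrightarrow> p - q \<in> polys_on F"
  using polys_on_add[of p F "- q"] polys_on_uminus[of q F] by simp

lemma polys_on_sum: "(\<And>i. i \<in> A \<Longrightarrow> f i \<in> polys_on F) \<Longrightarrow> sum f A \<in> polys_on F"
  by (induction A rule: infinite_finite_induct) (auto intro: polys_on_add)

lemma polys_on_single: "e \<in> F \<Longrightarrow> Poly_Mapping.single e c \<in> polys_on F"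
  by (simp add: polys_on_def)

lemma polys_on_single_iff: "c \<noteq> 0 \<Longrightarrow> Poly_Mapping.single e c \<in> polys_on F \<longleftrightarrow> e \<in> F"
  by (simp add: polys_on_def)

lemma polys_on_mono: "F \<subseteq> G \<Longrightarrow> polys_on F \<subseteq> polys_on G"
  by (auto simp: polys_on_def)

lemma polys_on_mult:
  assumes "p \<in> polys_on F" "q \<in> polys_on G" "\<And>e g. e \<in> F \<Longrightarrow> g \<in> G \<Longrightarrow> e + g \<in> H"
  shows "p * q \<in> polys_on H"
  using assms keys_mult[of p q] by (fastforce simp: polys_on_def)

lemma monomial_expansion:
  assumes "finite A" "Poly_Mapping.keys p \<subseteq> A"
  shows "p = (\<Sum>e\<in>A. Poly_Mapping.single e (Poly_Mapping.lookup p e))"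
proof (rule poly_mapping_eqI)
  fix k
  have "(\<Sum>e\<in>A. Poly_Mapping.lookup (Poly_Mapping.single e (Poly_Mapping.lookup p e)) k)
      = (\<Sum>e\<in>A. if e = k then Poly_Mapping.lookup p k else 0)"
    by (rule sum.cong) (auto simp: lookup_single when_def)
  also have "\<dots> = Poly_Mapping.lookup p k"
    using assms by (auto simp: in_keys_iff)
  finally show "Poly_Mapping.lookup p k =
      Poly_Mapping.lookup (\<Sum>e\<in>A. Poly_Mapping.single e (Poly_Mapping.lookup p e)) k"
    by (simp add: lookup_sum)
qed

lemma lookup_single_mult:
  fixes p :: "'k::field mpoly"
  shows "Poly_Mapping.lookup (Poly_Mapping.single g c * p) k =
    (\<Sum>e\<in>Poly_Mapping.keys p. if g + e = k then c * Poly_Mapping.lookup p e else 0)"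
proof -
  have "Poly_Mapping.single g c * p =
      Poly_Mapping.single g c * (\<Sum>e\<in>Poly_Mapping.keys p. Poly_Mapping.single e (Poly_Mapping.lookup p e))"
    using monomial_expansion[of "Poly_Mapping.keys p" p] by simp
  also have "\<dots> = (\<Sum>e\<in>Poly_Mapping.keys p. Poly_Mapping.single (g + e) (c * Poly_Mapping.lookup p e))"
    by (simp add: sum_distrib_left mult_single)
  finally show ?thesis
    by (simp add: lookup_sum lookup_single when_def)
qed

lemma lookup_single_mult_add:
  fixes p :: "'k::field mpoly"
  shows "Poly_Mapping.lookup (Poly_Mapping.single g c * p) (g + e) = c * Poly_Mapping.lookup p e"
proof -
  have "Poly_Mapping.lookup (Poly_Mapping.single g c * p) (g + e) =
    (\<Sum>e'\<in>Poly_Mapping.keys p. if e' = e then c * Poly_Mapping.lookup p e' else 0)"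
    by (simp add: lookup_single_mult)
  then show ?thesis by (simp add: in_keys_iff)
qed

lemma lookup_single_mult_neq:
  fixes p :: "'k::field mpoly"
  assumes "\<And>e. e \<in> Poly_Mapping.keys p \<Longrightarrow> g + e \<noteq> k"
  shows "Poly_Mapping.lookup (Poly_Mapping.single g c * p) k = 0"
  unfolding lookup_single_mult by (rule sum.neutral) (use assms in auto)

section \<open>Substitutions that send monomials to monomials\<close>

definition reduce :: "((nat \<Rightarrow>\<^sub>0 nat) \<Rightarrow> (nat \<Rightarrow>\<^sub>0 nat)) \<Rightarrow> 'k::field mpoly \<Rightarrow> 'k mpoly" where
  "reduce \<pi> p = (\<Sum>e\<in>Poly_Mapping.keys p. Poly_Mapping.single (\<pi> e) (Poly_Mapping.lookup p e))"

lemma reduce_superset: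
  assumes "finite A" "Poly_Mapping.keys p \<subseteq> A"
  shows "reduce \<pi> p = (\<Sum>e\<in>A. Poly_Mapping.single (\<pi> e) (Poly_Mapping.lookup p e))"
  unfolding reduce_def by (rule sum.mono_neutral_left) (use assms in \<open>auto simp: in_keys_iff\<close>)

lemma reduce_zero [simp]: "reduce \<pi> 0 = 0"
  by (simp add: reduce_def)

lemma reduce_single [simp]: "reduce \<pi> (Poly_Mapping.single e c) = Poly_Mapping.single (\<pi> e) c"
  by (cases "c = 0") (simp_all add: reduce_def)

lemma reduce_add: "reduce \<pi> (p + q) = reduce \<pi> p + reduce \<pi> q"
proof -
  let ?A = "Poly_Mapping.keys p \<union> Poly_Mapping.keys q"
  have "Poly_Mapping.keys (p + q) \<subseteq> ?A" by (rule keys_add)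
  then show ?thesis
    by (simp add: reduce_superset[of ?A] lookup_add single_add sum.distrib)
qed

lemma reduce_uminus: "reduce \<pi> (- p) = - reduce \<pi> p"
  by (metis add.inverse_unique add.right_inverse reduce_add reduce_zero)

lemma reduce_diff: "reduce \<pi> (p - q) = reduce \<pi> p - reduce \<pi> q"
  using reduce_add[of \<pi> p "- q"] by (simp add: reduce_uminus)

lemma reduce_sum: "reduce \<pi> (sum f A) = (\<Sum>i\<in>A. reduce \<pi> (f i))"
  by (induction A rule: infinite_finite_induct) (simp_all add: reduce_add)

lemma reduce_reduce: "reduce \<pi> (reduce \<rho> p) = reduce (\<pi> \<circ> \<rho>) p"
  by (simp add: reduce_def[of \<rho>] reduce_sum) (simp add: reduce_def)

lemma reduce_id_on:
  assumes "p \<in> polys_on F" "\<And>e. e \<in> F \<Longrightarrow> \<pi> e = e"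
  shows "reduce \<pi> p = p"
proof -
  have "reduce \<pi> p = (\<Sum>e\<in>Poly_Mapping.keys p. Poly_Mapping.single e (Poly_Mapping.lookup p e))"
    unfolding reduce_def using assms by (intro sum.cong) (auto simp: polys_on_def)
  then show ?thesis
    using monomial_expansion[of "Poly_Mapping.keys p" p] by simp
qed

text \<open>For additive \<open>\<pi>\<close> the linear map \<open>reduce \<pi>\<close> is
  multiplicative. A monomial factor is the case that arises here, from the two terms of x_a -
  x_b.\<close>

lemma reduce_single_mult:
  assumes "\<And>e e'. \<pi> (e + e') = \<pi> e + \<pi> e'"
  shows "reduce \<pi> (Poly_Mapping.single g c * p) = Poly_Mapping.single (\<pi> g) c * reduce \<pi> p"
proof -
  have "Poly_Mapping.single g c * p =
      (\<Sum>e\<in>Poly_Mapping.keys p. Poly_Mapping.single (g + e) (c * Poly_Mapping.lookup p e))"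
    by (subst monomial_expansion[of "Poly_Mapping.keys p" p])
      (simp_all add: sum_distrib_left mult_single)
  then show ?thesis
    by (simp add: reduce_sum assms) (simp add: reduce_def sum_distrib_left mult_single)
qed

lemma reduce_mem: "p \<in> polys_on F \<Longrightarrow> reduce \<pi> p \<in> polys_on (\<pi> ` F)"
  unfolding reduce_def by (intro polys_on_sum polys_on_single) (auto simp: polys_on_def)

text \<open>The exponent map of the substitution x_a := x_b.\<close>

definition merge :: "nat \<Rightarrow> nat \<Rightarrow> (nat \<Rightarrow>\<^sub>0 nat) \<Rightarrow> (nat \<Rightarrow>\<^sub>0 nat)" where
  "merge a b e = Poly_Mapping.update a 0
    (Poly_Mapping.update b (Poly_Mapping.lookup e b + Poly_Mapping.lookup e a) e)"

lemma lookup_merge: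
  "Poly_Mapping.lookup (merge a b e) v =
    (if v = a then 0 else if v = b then Poly_Mapping.lookup e b + Poly_Mapping.lookup e a
     else Poly_Mapping.lookup e v)"
  by (simp add: merge_def lookup_update)

lemma merge_add: "merge a b (e + e') = merge a b e + merge a b e'"
  by (rule poly_mapping_eqI) (simp add: lookup_merge lookup_add)

lemma merge_mem: "b < n \<Longrightarrow> e \<in> exponents n \<Longrightarrow> merge a b e \<in> exponents n"
  by (auto simp: exponents_iff lookup_merge)

lemma merge_fixed: "a \<noteq> b \<Longrightarrow> Poly_Mapping.lookup e a = 0 \<Longrightarrow> merge a b e = e"
  by (rule poly_mapping_eqI) (simp add: lookup_merge)

lemma merge_single: "a \<noteq> b \<Longrightarrow> merge a b (Poly_Mapping.single a m) = Poly_Mapping.single b m"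
  by (rule poly_mapping_eqI) (auto simp: lookup_merge lookup_single when_def)

definition var :: "nat \<Rightarrow> 'k::field mpoly" where
  "var i = Poly_Mapping.single (Poly_Mapping.single i (Suc 0)) 1"

lemma var_power: "var i ^ m = Poly_Mapping.single (Poly_Mapping.single i m) 1"
  by (induction m) (simp_all add: var_def mult_single single_add[symmetric])

text \<open>The number n stays free, so \<open>is_ideal\<close>, \<open>adjoin\<close>,
  \<open>var_ideal\<close> and the other notions above take it as their first argument from here
  on.\<close>

interpretation unital_subring "polys_on (exponents n) :: 'k::field mpoly set"
  by unfold_locales
    (auto intro: polys_on_add polys_on_uminus polys_on_mult
      simp: polys_on_single simp flip: single_one)

interpretation koszul "polys_on (exponents n) :: 'k::field mpoly set" var n
  by unfold_locales (simp add: var_def polys_on_single)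

lemma poly_ring_eq: "poly_ring n = ring_on (polys_on (exponents n))"
  by (simp add: poly_ring_def ring_on_def polys_on_def)

lemma graded_maximal_ideal_eq: "graded_maximal_ideal n = (var_ideal n :: 'k::field mpoly set)"
proof -
  have "variables n = (var ` {..<n} :: 'k mpoly set)"
    by (auto simp: variables_def var_def)
  then show ?thesis
    by (simp add: graded_maximal_ideal_def poly_ring_eq var_ideal_eq_genideal)
qed

section \<open>Monomial ideals as sets of exponents\<close>

definition exponent_ideal :: "nat \<Rightarrow> (nat \<Rightarrow>\<^sub>0 nat) set \<Rightarrow> bool" where
  "exponent_ideal n E \<longleftrightarrow> E \<subseteq> exponents n \<and> (\<forall>e\<in>E. \<forall>g\<in>exponents n. e + g \<in> E)"

lemma is_ideal_polys_on:
  assumes "exponent_ideal n E"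
  shows "is_ideal n (polys_on E :: 'k::field mpoly set)"
proof -
  have "s * p \<in> polys_on E" if "s \<in> polys_on (exponents n)" "p \<in> polys_on E" for s p :: "'k mpoly"
    using that assms by (auto intro!: polys_on_mult[of s "exponents n" p E]
        simp: exponent_ideal_def) (metis add.commute)
  then show ?thesis
    using assms polys_on_mono[of E "exponents n"] unfolding is_ideal_def exponent_ideal_def
    by (auto intro: polys_on_add)
qed

lemma polys_on_eq_genideal:
  assumes E: "exponent_ideal n E"
  shows "polys_on E = genideal (poly_ring n) ((\<lambda>e. Poly_Mapping.single e (1 :: 'k::field)) ` E)"
proof
  have "polys_on E \<subseteq> K"
    if K: "is_ideal n K" "(\<lambda>e. Poly_Mapping.single e (1 :: 'k)) ` E \<subseteq> K" for K
  proof
    fix p :: "'k mpoly" assume p: "p \<in> polys_on E"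
    have "Poly_Mapping.single e (Poly_Mapping.lookup p e) \<in> K" if "e \<in> Poly_Mapping.keys p" for e
    proof -
      have "Poly_Mapping.single 0 (Poly_Mapping.lookup p e) * Poly_Mapping.single e 1 \<in> K"
        using that p K by (intro ideal_mult[OF K(1)] polys_on_single) (auto simp: polys_on_def)
      then show ?thesis by (simp add: mult_single)
    qed
    then show "p \<in> K"
      by (subst monomial_expansion[of "Poly_Mapping.keys p" p]) (auto intro: ideal_sum[OF K(1)])
  qed
  then show "polys_on E \<subseteq> genideal (poly_ring n) ((\<lambda>e. Poly_Mapping.single e (1 :: 'k)) ` E)"
    unfolding genideal_def poly_ring_eq ideal_iff by blast
  have "(\<lambda>e. Poly_Mapping.single e (1 :: 'k)) ` E \<subseteq> polys_on E"
    by (auto intro: polys_on_single)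
  then show "genideal (poly_ring n) ((\<lambda>e. Poly_Mapping.single e (1 :: 'k)) ` E) \<subseteq> polys_on E"
    using is_ideal_polys_on[OF E] unfolding genideal_def poly_ring_eq ideal_iff by blast
qed

text \<open>Both sides are spanned by the monomials with exponent e + g: a product expands into such
  terms, and conversely the coefficient of a term can be placed on its first factor.\<close>

lemma ideal_prod_polys_on:
  "ideal_prod (poly_ring n) (polys_on E) (polys_on F :: 'k::field mpoly set) =
    polys_on {e + g | e g. e \<in> E \<and> g \<in> F}" (is "?L = polys_on ?G")
proof
  show "?L \<subseteq> polys_on ?G"
  proof
    fix p assume "p \<in> ?L"
    then show "p \<in> polys_on ?G"
      by (induction rule: ideal_prod.induct)
        (auto simp: poly_ring_def intro: polys_on_mult polys_on_add)
  qed
  show "polys_on ?G \<subseteq> ?L"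
  proof
    fix p :: "'k mpoly" assume p: "p \<in> polys_on ?G"
    have single: "Poly_Mapping.single k c \<in> ?L" if "k \<in> ?G" for k and c :: 'k
    proof -
      obtain e g where "k = e + g" "e \<in> E" "g \<in> F" using \<open>k \<in> ?G\<close> by blast
      then show ?thesis
        using ideal_prod.prod[of "Poly_Mapping.single e c" "polys_on E" "Poly_Mapping.single g 1"
            "polys_on F" "poly_ring n"]
        by (simp add: polys_on_single poly_ring_def mult_single)
    qed
    have "(\<Sum>e\<in>A. Poly_Mapping.single e (Poly_Mapping.lookup p e)) \<in> ?L"
      if "finite A" "A \<noteq> {}" "A \<subseteq> ?G" for A
      using that
    proof (induction A rule: finite_ne_induct)
      case (insert k A)
      then show ?case
        using ideal_prod.sum[of "Poly_Mapping.single k (Poly_Mapping.lookup p k)" "poly_ring n"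
            "polys_on E" "polys_on F" "\<Sum>e\<in>A. Poly_Mapping.single e (Poly_Mapping.lookup p e)"] single
        by (simp add: poly_ring_def)
    qed (use single in simp)
    moreover have "0 \<in> ?L"
      using ideal_prod.prod[of 0 "polys_on E" 0 "polys_on F" "poly_ring n"] by (simp add: poly_ring_def)
    ultimately have "(\<Sum>e\<in>Poly_Mapping.keys p. Poly_Mapping.single e (Poly_Mapping.lookup p e)) \<in> ?L"
      using p by (cases "Poly_Mapping.keys p = {}") (auto simp: polys_on_def[of ?G])
    then show "p \<in> ?L"
      using monomial_expansion[of "Poly_Mapping.keys p" p] by simp
  qed
qed

lemma one_notin_var_ideal: "1 \<notin> (var_ideal n :: 'k::field mpoly set)"
proof
  assume "1 \<in> (var_ideal n :: 'k mpoly set)"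
  then obtain a where "(1 :: 'k mpoly) = (\<Sum>j<n. a j * var j)"
    unfolding var_ideal_def by blast
  then have "Poly_Mapping.lookup (1 :: 'k mpoly) 0 = Poly_Mapping.lookup (\<Sum>j<n. var j * a j) 0"
    by (simp only: mult.commute)
  also have "\<dots> = (\<Sum>j<n. Poly_Mapping.lookup (var j * a j) 0)"
    by (rule lookup_sum)
  also have "\<dots> = 0"
    unfolding var_def
  proof (intro sum.neutral ballI lookup_single_mult_neq)
    fix j and e :: "nat \<Rightarrow>\<^sub>0 nat"
    have "Poly_Mapping.lookup (Poly_Mapping.single j (Suc 0) + e) j \<noteq> (0 :: nat)"
      by (simp add: lookup_add)
    then show "Poly_Mapping.single j (Suc 0) + e \<noteq> (0 :: nat \<Rightarrow>\<^sub>0 nat)"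
      by (metis lookup_zero)
  qed
  finally show False by simp
qed

lemma polys_on_subset_var_ideal:
  assumes "E \<subseteq> exponents n" "0 \<notin> E"
  shows "polys_on E \<subseteq> (var_ideal n :: 'k::field mpoly set)"
proof
  fix p :: "'k mpoly" assume p: "p \<in> polys_on E"
  have "Poly_Mapping.single e (Poly_Mapping.lookup p e) \<in> var_ideal n" if "e \<in> Poly_Mapping.keys p" for e
  proof -
    have e: "e \<in> E" using p that by (auto simp: polys_on_def)
    then have "e \<noteq> 0" using assms by auto
    then obtain i where i: "Poly_Mapping.lookup e i \<noteq> 0"
      by (metis lookup_zero poly_mapping_eqI)
    have i_n: "i < n" using e assms(1) i unfolding exponents_iff subset_iff by (metis leI)
    define g where "g = e - Poly_Mapping.single i (Suc 0)"
    have e_eq: "e = g + Poly_Mapping.single i (Suc 0)"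
      unfolding g_def using i
      by (intro poly_mapping_eqI) (auto simp: lookup_add lookup_minus lookup_single when_def)
    have "var i \<in> (var_ideal n :: 'k mpoly set)"
      using i_n unfolding var_ideal_eq_genideal by (auto simp: genideal_def)
    then have "Poly_Mapping.single g (Poly_Mapping.lookup p e) * var i \<in> var_ideal n"
      using e assms e_eq by (intro ideal_mult[OF is_ideal_var_ideal] polys_on_single) auto
    then show ?thesis by (simp add: var_def mult_single flip: e_eq)
  qed
  then show "p \<in> var_ideal n"
    by (subst monomial_expansion[of "Poly_Mapping.keys p" p])
      (auto intro: ideal_sum[OF is_ideal_var_ideal])
qed

section \<open>Merging variables\<close>

definition fixed_exponents :: "nat \<Rightarrow> nat set \<Rightarrow> (nat \<Rightarrow>\<^sub>0 nat) set" where
  "fixed_exponents n U = {e \<in> exponents n. \<forall>v\<in>U. Poly_Mapping.lookup e v = 0}"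

text \<open>The preimage in S of a monomial ideal in fewer variables. In this form the successive
  quotients by x_a - x_b remain quotients of the same ring S.\<close>

definition reduced_ideal ::
    "nat \<Rightarrow> ((nat \<Rightarrow>\<^sub>0 nat) \<Rightarrow> (nat \<Rightarrow>\<^sub>0 nat)) \<Rightarrow> (nat \<Rightarrow>\<^sub>0 nat) set \<Rightarrow> 'k::field mpoly set" where
  "reduced_ideal n \<pi> F = {p \<in> polys_on (exponents n). reduce \<pi> p \<in> polys_on F}"

lemma reduced_ideal_add:
  "p \<in> reduced_ideal n \<pi> F \<Longrightarrow> q \<in> reduced_ideal n \<pi> F \<Longrightarrow> p + q \<in> reduced_ideal n \<pi> F"
  by (auto simp: reduced_ideal_def reduce_add intro: polys_on_add)

text \<open>Suppose q has terms outside F. Outside F the terms of x_a q and x_b q cancel in pairs.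
  Following the pairs trades x_b for x_a and must stop, so every such term v has v x_a^N in F for
  some N; a term of maximal x_b-exponent also has v x_b in F. Then \<open>sat\<close> puts it into
  F.\<close>

lemma regular_binomial:
  fixes q :: "'k::field mpoly"
  assumes ab: "a \<noteq> b"
    and up: "\<And>e. e \<in> F \<Longrightarrow> e + Poly_Mapping.single a (Suc 0) \<in> F"
      "\<And>e. e \<in> F \<Longrightarrow> e + Poly_Mapping.single b (Suc 0) \<in> F"
    and sat: "\<And>v N. v \<in> Poly_Mapping.keys q \<Longrightarrow> v + Poly_Mapping.single a N \<in> F \<Longrightarrow>
      v + Poly_Mapping.single b N \<in> F \<Longrightarrow> v \<in> F"
    and q: "(var a - var b) * q \<in> polys_on F"
  shows "q \<in> polys_on F"
proof (rule ccontr)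
  let ?a = "Poly_Mapping.single a (Suc 0)" and ?b = "Poly_Mapping.single b (Suc 0)"
  have upN: "e + Poly_Mapping.single c N \<in> F" if "c = a \<or> c = b" "e \<in> F" for e c N
  proof (induction N)
    case (Suc N)
    have "e + Poly_Mapping.single c (Suc N) = (e + Poly_Mapping.single c N) + Poly_Mapping.single c (Suc 0)"
      by (simp add: add.assoc flip: single_add)
    then show ?case using up Suc that by auto
  qed (simp add: that)
  let ?B = "{v \<in> Poly_Mapping.keys q. v \<notin> F}"
  assume "q \<notin> polys_on F"
  then have B: "?B \<noteq> {}" "finite ?B"
    by (auto simp: polys_on_def)
  \<comment> \<open>Outside \<open>F\<close> the coefficients of the product cancel in pairs.\<close>
  have coeff: "Poly_Mapping.lookup (var a * q) k = Poly_Mapping.lookup (var b * q) k" if "k \<notin> F" for k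
    using q that by (auto simp: polys_on_def in_keys_iff left_diff_distrib lookup_minus subset_iff)
  have shift: "v + ?a \<in> F \<or> (\<exists>v'\<in>?B. v' + ?b = v + ?a)" if v: "v \<in> ?B" for v
  proof (rule ccontr)
    assume *: "\<not> ?thesis"
    have "Poly_Mapping.lookup (var b * q) (v + ?a) = 0"
      unfolding var_def
    proof (rule lookup_single_mult_neq)
      fix e assume e: "e \<in> Poly_Mapping.keys q"
      show "?b + e \<noteq> v + ?a"
      proof
        assume eq: "?b + e = v + ?a"
        then have "e \<in> F" using * e by (auto simp: add.commute)
        then have "v + ?a \<in> F" using up(2)[of e] eq by (simp add: add.commute)
        then show False using * by simp
      qed
    qed
    moreover have "Poly_Mapping.lookup (var a * q) (v + ?a) = Poly_Mapping.lookup q v"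
      unfolding var_def using lookup_single_mult_add[of ?a 1 q v] by (simp add: add.commute)
    ultimately show False
      using coeff[of "v + ?a"] * v by (simp add: in_keys_iff)
  qed
  \<comment> \<open>The partner v' = v x_a / x_b has a smaller x_b-exponent, and v' x_a^N in F
    implies v x_a^(N+1) in F.\<close>
  have climb_a: "\<exists>N. v + Poly_Mapping.single a N \<in> F" if "v \<in> ?B" for v
    using that
  proof (induction "Poly_Mapping.lookup v b" arbitrary: v rule: less_induct)
    case (less v)
    from shift[OF less.prems] show ?case
    proof
      assume "\<exists>v'\<in>?B. v' + ?b = v + ?a"
      then obtain v' where v': "v' \<in> ?B" "v' + ?b = v + ?a" by auto
      have "Poly_Mapping.lookup (v' + ?b) b = Poly_Mapping.lookup (v + ?a) b"
        using v' by simp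
      then have "Poly_Mapping.lookup v' b < Poly_Mapping.lookup v b"
        using ab by (simp add: lookup_add lookup_single)
      then obtain N where "v' + Poly_Mapping.single a N \<in> F"
        using less.hyps v' by blast
      then have "v' + Poly_Mapping.single a N + ?b \<in> F" by (rule up)
      moreover have "v' + Poly_Mapping.single a N + ?b = v + Poly_Mapping.single a (Suc N)"
      proof -
        have "v' + Poly_Mapping.single a N + ?b = (v' + ?b) + Poly_Mapping.single a N"
          by (simp add: ac_simps)
        then show ?thesis
          by (simp add: v'(2) add.assoc flip: single_add)
      qed
      ultimately show ?thesis by auto
    qed auto
  qed
  \<comment> \<open>Despite its name, \<open>min\<close> says that the x_b-exponent of v is maximal.
    A term of x_a q cancelling v x_b would come from v x_b / x_a, whose x_b-exponent is
    larger.\<close>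
  obtain v where v: "v \<in> ?B" and min: "\<And>v'. v' \<in> ?B \<Longrightarrow> Poly_Mapping.lookup v' b \<le> Poly_Mapping.lookup v b"
    using Max_in[of "(\<lambda>v. Poly_Mapping.lookup v b) ` ?B"] Max_ge[of "(\<lambda>v. Poly_Mapping.lookup v b) ` ?B"] B
    by (smt (verit, best) empty_is_image finite_imageI imageE imageI)
  have "v + ?b \<in> F"
  proof (rule ccontr)
    assume nF: "v + ?b \<notin> F"
    have "Poly_Mapping.lookup (var b * q) (v + ?b) = Poly_Mapping.lookup q v"
      unfolding var_def using lookup_single_mult_add[of ?b 1 q v] by (simp add: add.commute)
    moreover have "Poly_Mapping.lookup (var a * q) (v + ?b) = 0"
      unfolding var_def
    proof (rule lookup_single_mult_neq)
      fix e assume e: "e \<in> Poly_Mapping.keys q"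
      show "?a + e \<noteq> v + ?b"
      proof
        assume eq: "?a + e = v + ?b"
        then have "e \<notin> F" using nF up(1)[of e] by (auto simp: add.commute)
        moreover have "Poly_Mapping.lookup (?a + e) b = Poly_Mapping.lookup (v + ?b) b"
          using eq by simp
        ultimately show False
          using min[of e] e ab by (simp add: lookup_add lookup_single)
      qed
    qed
    ultimately show False
      using coeff[OF nF] v by (simp add: in_keys_iff)
  qed
  moreover obtain N where "v + Poly_Mapping.single a N \<in> F"
    using climb_a v by blast
  moreover have "v + Poly_Mapping.single a (N + 1) = v + Poly_Mapping.single a N + ?a"
    "v + Poly_Mapping.single b (N + 1) = v + ?b + Poly_Mapping.single b N"
    by (simp_all add: add.assoc flip: single_add)
  ultimately have "v + Poly_Mapping.single a (N + 1) \<in> F" "v + Poly_Mapping.single b (N + 1) \<in> F"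
    using up(1) upN by simp_all
  then show False using sat[of v "N + 1"] v by auto
qed

text \<open>A monomial x^g x_a^m, with x^g free of x_a, changes by x^g (x_a^m - x_b^m), a multiple
  of x_a - x_b.\<close>

lemma diff_reduce_merge:
  fixes q :: "'k::field mpoly"
  assumes ab: "a < n" "b < n" "a \<noteq> b" and q: "q \<in> polys_on (exponents n)"
  shows "\<exists>s\<in>polys_on (exponents n). q - reduce (merge a b) q = (var a - var b) * s"
proof -
  have mono: "\<exists>s\<in>polys_on (exponents n).
      Poly_Mapping.single e c - Poly_Mapping.single (merge a b e) c = (var a - var b) * s"
    if e: "e \<in> exponents n" for e and c :: 'k
  proof -
    define m where "m = Poly_Mapping.lookup e a"
    define g where "g = Poly_Mapping.update a 0 e"
    have e_eq: "e = g + Poly_Mapping.single a m"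
      by (rule poly_mapping_eqI) (simp add: g_def m_def lookup_add lookup_update lookup_single when_def)
    have g: "g \<in> exponents n" using e e_eq by simp
    have "merge a b g = g"
      using ab by (intro merge_fixed) (simp_all add: g_def lookup_update)
    then have merge_eq: "merge a b e = g + Poly_Mapping.single b m"
      using ab by (simp add: e_eq merge_add merge_single)
    let ?s = "Poly_Mapping.single g c * (\<Sum>i<m. var b ^ (m - Suc i) * var a ^ i)"
    have "Poly_Mapping.single e c - Poly_Mapping.single (merge a b e) c =
        Poly_Mapping.single g c * (var a ^ m - var b ^ m)"
      by (simp add: right_diff_distrib var_power mult_single merge_eq flip: e_eq)
    also have "\<dots> = (var a - var b) * ?s"
      by (subst power_diff_sumr2) (simp add: ac_simps)
    finally have "Poly_Mapping.single e c - Poly_Mapping.single (merge a b e) c = (var a - var b) * ?s" .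
    moreover have "?s \<in> polys_on (exponents n)"
      unfolding var_power using ab g by (intro mult_mem sum_mem polys_on_single) auto
    ultimately show ?thesis by blast
  qed
  have "\<forall>e. \<exists>s\<in>polys_on (exponents n). e \<in> exponents n \<longrightarrow>
      Poly_Mapping.single e (Poly_Mapping.lookup q e) -
      Poly_Mapping.single (merge a b e) (Poly_Mapping.lookup q e) = (var a - var b) * s"
    using mono zero_mem by blast
  then obtain s where s: "\<And>e. s e \<in> polys_on (exponents n)"
    and s_eq: "\<And>e. e \<in> exponents n \<Longrightarrow> Poly_Mapping.single e (Poly_Mapping.lookup q e) -
      Poly_Mapping.single (merge a b e) (Poly_Mapping.lookup q e) = (var a - var b) * s e"
    by metis
  have "q - reduce (merge a b) q = (\<Sum>e\<in>Poly_Mapping.keys q.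
      Poly_Mapping.single e (Poly_Mapping.lookup q e) -
      Poly_Mapping.single (merge a b e) (Poly_Mapping.lookup q e))"
    unfolding sum_subtractf reduce_def
    using monomial_expansion[of "Poly_Mapping.keys q" q] by simp
  also have "\<dots> = (var a - var b) * (\<Sum>e\<in>Poly_Mapping.keys q. s e)"
    unfolding sum_distrib_left using q by (intro sum.cong refl s_eq) (auto simp: polys_on_def)
  finally show ?thesis
    by (intro bexI[of _ "\<Sum>e\<in>Poly_Mapping.keys q. s e"] sum_mem s)
qed

text \<open>The invariant of the elimination: \<open>\<pi>\<close> is the exponent map of a
  retraction of S onto the polynomial ring in the variables outside U, and F is a monomial ideal of
  that smaller ring.\<close>

definition merged_state ::
    "nat \<Rightarrow> nat set \<Rightarrow> ((nat \<Rightarrow>\<^sub>0 nat) \<Rightarrow> (nat \<Rightarrow>\<^sub>0 nat)) \<Rightarrow> (nat \<Rightarrow>\<^sub>0 nat) set \<Rightarrow> bool" where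
  "merged_state n U \<pi> F \<longleftrightarrow>
    (\<forall>e e'. \<pi> (e + e') = \<pi> e + \<pi> e') \<and>
    (\<forall>e\<in>fixed_exponents n U. \<pi> e = e) \<and> \<pi> ` exponents n \<subseteq> fixed_exponents n U \<and>
    F \<subseteq> fixed_exponents n U \<and> (\<forall>e\<in>F. \<forall>g\<in>fixed_exponents n U. e + g \<in> F)"

lemma merged_state_insert:
  assumes st: "merged_state n U \<pi> F" and ab: "a < n" "b < n" "a \<noteq> b" "a \<notin> U" "b \<notin> U"
  shows "merged_state n (insert a U) (merge a b \<circ> \<pi>) (merge a b ` F)"
proof -
  have add: "\<And>e e'. \<pi> (e + e') = \<pi> e + \<pi> e'" and id: "\<And>e. e \<in> fixed_exponents n U \<Longrightarrow> \<pi> e = e"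
    and im: "\<And>e. e \<in> exponents n \<Longrightarrow> \<pi> e \<in> fixed_exponents n U"
    and F: "\<And>e. e \<in> F \<Longrightarrow> e \<in> fixed_exponents n U"
    using st by (auto simp: merged_state_def)
  have fixed: "fixed_exponents n (insert a U) \<subseteq> fixed_exponents n U"
    by (auto simp: fixed_exponents_def)
  have merge_id: "merge a b e = e" if "e \<in> fixed_exponents n (insert a U)" for e
    using that ab by (intro merge_fixed) (auto simp: fixed_exponents_def)
  have merge_in: "merge a b e \<in> fixed_exponents n (insert a U)" if "e \<in> fixed_exponents n U" for e
    using that ab merge_mem[of b n e a] by (auto simp: fixed_exponents_def lookup_merge)
  have "merge a b e + g \<in> merge a b ` F" if "e \<in> F" "g \<in> fixed_exponents n (insert a U)" for e g
  proof -
    have "merge a b e + g = merge a b (e + g)"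
      using that by (simp add: merge_add merge_id)
    moreover have "e + g \<in> F"
      using st that fixed by (auto simp: merged_state_def)
    ultimately show ?thesis by simp
  qed
  then have "\<forall>e\<in>merge a b ` F. \<forall>g\<in>fixed_exponents n (insert a U). e + g \<in> merge a b ` F"
    by blast
  moreover have "(merge a b \<circ> \<pi>) ` exponents n \<subseteq> fixed_exponents n (insert a U)"
    "merge a b ` F \<subseteq> fixed_exponents n (insert a U)"
    using im F merge_in by auto
  moreover have "(merge a b \<circ> \<pi>) e = e" if "e \<in> fixed_exponents n (insert a U)" for e
    using id[of e] merge_id[OF that] that fixed by auto
  moreover have "(merge a b \<circ> \<pi>) (e + e') = (merge a b \<circ> \<pi>) e + (merge a b \<circ> \<pi>) e'" for e e'
    by (simp add: add merge_add)
  ultimately show ?thesis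
    unfolding merged_state_def by blast
qed

text \<open>The substitution x_a := x_b kills x_a - x_b, and it changes a polynomial only by a
  multiple of x_a - x_b; these facts give the two inclusions.\<close>

lemma reduced_ideal_step:
  assumes st: "merged_state n U \<pi> F" and ab: "a < n" "b < n" "a \<noteq> b" "a \<notin> U" "b \<notin> U"
  shows "adjoin n (reduced_ideal n \<pi> F) (var a - var b) =
    (reduced_ideal n (merge a b \<circ> \<pi>) (merge a b ` F) :: 'k::field mpoly set)"
proof
  let ?L = "reduced_ideal n \<pi> F :: 'k mpoly set"
  let ?y = "var a - var b :: 'k mpoly"
  have add: "\<And>e e'. \<pi> (e + e') = \<pi> e + \<pi> e'" and id: "\<And>e. e \<in> fixed_exponents n U \<Longrightarrow> \<pi> e = e"
    and im: "\<And>e. e \<in> exponents n \<Longrightarrow> \<pi> e \<in> fixed_exponents n U" and F: "F \<subseteq> fixed_exponents n U"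
    using st by (auto simp: merged_state_def)
  have fixed_exp: "fixed_exponents n U \<subseteq> exponents n"
    by (auto simp: fixed_exponents_def)
  have y: "?y \<in> polys_on (exponents n)"
    using ab by (simp add: var_def polys_on_diff polys_on_single)
  have \<pi>_single: "\<pi> (Poly_Mapping.single v (Suc 0)) = Poly_Mapping.single v (Suc 0)" if "v = a \<or> v = b" for v
    using that ab by (intro id) (auto simp: fixed_exponents_def lookup_single when_def)
  show "adjoin n ?L ?y \<subseteq> reduced_ideal n (merge a b \<circ> \<pi>) (merge a b ` F)"
  proof
    fix p assume "p \<in> adjoin n ?L ?y"
    then obtain l s where p: "p = l + ?y * s" and l: "l \<in> ?L" and s: "s \<in> polys_on (exponents n)"
      by (auto simp: adjoin_def)
    have "reduce (merge a b \<circ> \<pi>) (?y * s) = 0"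
      unfolding reduce_reduce[symmetric]
      using ab by (simp add: var_def left_diff_distrib reduce_diff reduce_single_mult add merge_add
          \<pi>_single merge_single merge_fixed lookup_single)
    moreover have "reduce (merge a b \<circ> \<pi>) l \<in> polys_on (merge a b ` F)"
      using l reduce_mem[of "reduce \<pi> l" F "merge a b"] by (simp add: reduced_ideal_def reduce_reduce)
    moreover have "p \<in> polys_on (exponents n)"
      unfolding p using l s y by (auto simp: reduced_ideal_def)
    ultimately show "p \<in> reduced_ideal n (merge a b \<circ> \<pi>) (merge a b ` F)"
      by (simp add: reduced_ideal_def p reduce_add)
  qed
  show "reduced_ideal n (merge a b \<circ> \<pi>) (merge a b ` F) \<subseteq> adjoin n ?L ?y"
  proof
    fix p :: "'k mpoly" assume "p \<in> reduced_ideal n (merge a b \<circ> \<pi>) (merge a b ` F)"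
    then have p: "p \<in> polys_on (exponents n)"
      and rp: "reduce (merge a b) (reduce \<pi> p) \<in> polys_on (merge a b ` F)"
      by (simp_all add: reduced_ideal_def reduce_reduce)
    define q where "q = reduce \<pi> p"
    define r where "r = reduce (merge a b) q"
    \<comment> \<open>A preimage in F for each merged exponent. It lifts r to a polynomial r'
      supported on F whose image is again r.\<close>
    define g where "g = inv_into F (merge a b)"
    define r' where "r' = reduce g r"
    have q_fixed: "q \<in> polys_on (fixed_exponents n U)"
      using reduce_mem[OF p, of \<pi>] im polys_on_mono[of "\<pi> ` exponents n" "fixed_exponents n U"]
      unfolding q_def by blast
    then have q: "q \<in> polys_on (exponents n)"
      using polys_on_mono[OF fixed_exp] by blast
    have r: "r \<in> polys_on (merge a b ` F)"
      using rp by (simp add: r_def q_def)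
    have "g ` merge a b ` F \<subseteq> F"
      unfolding g_def by (auto intro: inv_into_into)
    then have r'F: "r' \<in> polys_on F"
      using reduce_mem[OF r, of g] polys_on_mono unfolding r'_def by blast
    then have r'_fixed: "r' \<in> polys_on (fixed_exponents n U)"
      using polys_on_mono[OF F] by blast
    then have r': "r' \<in> polys_on (exponents n)"
      using polys_on_mono[OF fixed_exp] by blast
    have r_eq: "reduce (merge a b) r' = r"
      unfolding r'_def reduce_reduce using r
      by (rule reduce_id_on) (auto simp: g_def f_inv_into_f)
    have "reduce \<pi> r' = r'" using r'_fixed id by (rule reduce_id_on)
    then have "r' \<in> ?L" using r' r'F by (simp add: reduced_ideal_def)
    moreover have "reduce \<pi> q = q" using q_fixed id by (rule reduce_id_on)
    then have "p - q \<in> ?L"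
      using p q by (simp add: reduced_ideal_def reduce_diff flip: q_def)
    ultimately have L: "p - q + r' \<in> ?L"
      using reduced_ideal_add by blast
    obtain s where s: "s \<in> polys_on (exponents n)" "q - r = ?y * s"
      using diff_reduce_merge[OF ab(1-3) q] unfolding r_def by blast
    obtain s' where s': "s' \<in> polys_on (exponents n)" "r' - r = ?y * s'"
      using diff_reduce_merge[OF ab(1-3) r'] unfolding r_eq by blast
    \<comment> \<open>Here p - q lies in the old ideal because \<open>reduce \<pi>\<close> sends it
      to 0, r' lies there because its exponents are in F, and q and r' both differ from r by
      multiples of x_a - x_b.\<close>
    have "p = (p - q + r') + ((q - r) - (r' - r))" by simp
    also have "\<dots> = (p - q + r') + ?y * (s - s')"
      unfolding s s' by (simp add: right_diff_distrib)
    finally show "p \<in> adjoin n ?L ?y"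
      using L s(1) s'(1) diff_mem unfolding adjoin_def by blast
  qed
qed

text \<open>\<open>reduce \<pi>\<close> fixes x_a - x_b, so the product can be examined in the
  smaller ring, by \<open>regular_binomial\<close>.\<close>

lemma regular_on_reduced_ideal:
  assumes st: "merged_state n U \<pi> F" and ab: "a < n" "b < n" "a \<noteq> b" "a \<notin> U" "b \<notin> U"
    and sat: "\<And>v N. v \<in> fixed_exponents n U \<Longrightarrow> v + Poly_Mapping.single a N \<in> F \<Longrightarrow>
      v + Poly_Mapping.single b N \<in> F \<Longrightarrow> v \<in> F"
  shows "regular_on n (reduced_ideal n \<pi> F :: 'k::field mpoly set) (var a - var b)"
  unfolding regular_on_def
proof (intro ballI impI)
  fix p :: "'k mpoly"
  assume p: "p \<in> polys_on (exponents n)" and yp: "(var a - var b) * p \<in> reduced_ideal n \<pi> F"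
  have add: "\<And>e e'. \<pi> (e + e') = \<pi> e + \<pi> e'" and id: "\<And>e. e \<in> fixed_exponents n U \<Longrightarrow> \<pi> e = e"
    and im: "\<pi> ` exponents n \<subseteq> fixed_exponents n U"
    and up: "\<And>e g. e \<in> F \<Longrightarrow> g \<in> fixed_exponents n U \<Longrightarrow> e + g \<in> F"
    using st by (auto simp: merged_state_def)
  have single: "Poly_Mapping.single v (Suc 0) \<in> fixed_exponents n U" if "v = a \<or> v = b" for v
    using that ab by (auto simp: fixed_exponents_def lookup_single when_def)
  have "reduce \<pi> ((var a - var b) * p) = (var a - var b) * reduce \<pi> p"
    by (simp add: var_def left_diff_distrib reduce_diff reduce_single_mult add single id)
  then have red: "(var a - var b) * reduce \<pi> p \<in> polys_on F"
    using yp by (simp add: reduced_ideal_def)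
  have keys: "v \<in> fixed_exponents n U" if "v \<in> Poly_Mapping.keys (reduce \<pi> p)" for v
    using reduce_mem[OF p, of \<pi>] im that by (auto simp: polys_on_def)
  have "reduce \<pi> p \<in> polys_on F"
  proof (rule regular_binomial[OF ab(3) _ _ _ red])
    fix e assume "e \<in> F"
    then show "e + Poly_Mapping.single a (Suc 0) \<in> F" "e + Poly_Mapping.single b (Suc 0) \<in> F"
      using up single by blast+
  qed (use keys sat in blast)
  then show "p \<in> reduced_ideal n \<pi> F"
    using p by (simp add: reduced_ideal_def)
qed

text \<open>A holds the variables to be eliminated, \<open>\<beta> a\<close> is the surviving
  variable into which a is merged, and \<open>F U\<close> is the monomial ideal after U has been
  merged. Indexing F by sets makes it independent of the order of elimination. The monomial u is a
  socle element of the last quotient.\<close>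

theorem depth_monomial_quotient:
  fixes E :: "(nat \<Rightarrow>\<^sub>0 nat) set" and \<beta> :: "nat \<Rightarrow> nat" and F :: "nat set \<Rightarrow> (nat \<Rightarrow>\<^sub>0 nat) set"
  assumes E: "exponent_ideal n E" "0 \<notin> E"
    and A: "A \<subseteq> {..<n}" "\<beta> ` A \<subseteq> {..<n} - A"
    and F0: "F {} = E"
    and F_step: "\<And>U a. U \<subseteq> A \<Longrightarrow> a \<in> A - U \<Longrightarrow> F (insert a U) = merge a (\<beta> a) ` F U"
    and sat: "\<And>U a v N. U \<subseteq> A \<Longrightarrow> a \<in> A - U \<Longrightarrow> v \<in> fixed_exponents n U \<Longrightarrow>
      v + Poly_Mapping.single a N \<in> F U \<Longrightarrow> v + Poly_Mapping.single (\<beta> a) N \<in> F U \<Longrightarrow> v \<in> F U"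
    and u: "u \<in> fixed_exponents n A" "u \<notin> F A"
      "\<And>v. v \<in> {..<n} - A \<Longrightarrow> u + Poly_Mapping.single v (Suc 0) \<in> F A"
  shows "depth (poly_ring n) (graded_maximal_ideal n)
    (quot_module (regular_module (poly_ring n)) (polys_on E :: 'k::field mpoly set)) = enat (card A)"
proof -
  define ys :: "nat list \<Rightarrow> 'k mpoly list" where "ys = map (\<lambda>a. var a - var (\<beta> a))"
  let ?Q = "polys_on E :: 'k mpoly set"
  have id_eq: "reduced_ideal n id E = ?Q"
    using E reduce_id_on[of _ "exponents n" id] polys_on_mono[of E "exponents n"]
    by (auto simp: reduced_ideal_def exponent_ideal_def)
  have main: "\<exists>\<pi>. merged_state n (set as) \<pi> (F (set as)) \<and> weakly_regular n ?Q (ys as) \<and>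
      adjoins n ?Q (ys as) = reduced_ideal n \<pi> (F (set as))"
    if "distinct as" "set as \<subseteq> A" for as
    using that
  proof (induction as rule: rev_induct)
    case Nil
    have "merged_state n {} id E"
      using E by (auto simp: merged_state_def exponent_ideal_def fixed_exponents_def)
    then show ?case
      using id_eq by (auto simp: ys_def F0)
  next
    case (snoc a as)
    then obtain \<pi> where st: "merged_state n (set as) \<pi> (F (set as))" and reg: "weakly_regular n ?Q (ys as)"
      and adj: "adjoins n ?Q (ys as) = reduced_ideal n \<pi> (F (set as))"
      by auto
    have a: "a < n" "\<beta> a < n" "a \<noteq> \<beta> a" "a \<notin> set as" "\<beta> a \<notin> set as" "a \<in> A - set as"
      using snoc.prems A by auto
    have "set as \<subseteq> A" using snoc.prems by simp
    note step = F_step[OF this a(6)] and sat' = sat[OF this a(6)]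
    have "merged_state n (set (as @ [a])) (merge a (\<beta> a) \<circ> \<pi>) (F (set (as @ [a])))"
      using merged_state_insert[OF st a(1-5)] by (simp add: step)
    moreover have "weakly_regular n ?Q (ys (as @ [a]))"
      using reg regular_on_reduced_ideal[OF st a(1-5) sat', where 'k = 'k]
      by (simp add: ys_def weakly_regular_append adj[unfolded ys_def])
    moreover have "adjoins n ?Q (ys (as @ [a])) =
        reduced_ideal n (merge a (\<beta> a) \<circ> \<pi>) (F (set (as @ [a])))"
      using reduced_ideal_step[OF st a(1-5), where 'k = 'k]
      by (simp add: ys_def adjoins_snoc step adj[unfolded ys_def])
    ultimately show ?case by blast
  qed
  have finA: "finite A" using A finite_subset by blast
  then obtain as where as: "set as = A" "distinct as" using finite_distinct_list by blast
  obtain \<pi> where st: "merged_state n A \<pi> (F A)" and reg: "weakly_regular n ?Q (ys as)"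
    and adj: "adjoins n ?Q (ys as) = reduced_ideal n \<pi> (F A)"
    using main[of as] as by auto
  have id: "\<And>e. e \<in> fixed_exponents n A \<Longrightarrow> \<pi> e = e" and FA: "F A \<subseteq> fixed_exponents n A"
    using st by (auto simp: merged_state_def)
  have var_in: "var v \<in> (var_ideal n :: 'k mpoly set)" if "v < n" for v
    using that unfolding var_ideal_eq_genideal by (auto simp: genideal_def)
  have ys_sub: "set (ys as) \<subseteq> var_ideal n"
    using A as var_in by (auto simp: ys_def intro!: ideal_diff[OF is_ideal_var_ideal])
  have Q: "is_ideal n ?Q" by (rule is_ideal_polys_on[OF E(1)])
  have Q_sub: "?Q \<subseteq> var_ideal n"
    using E by (intro polys_on_subset_var_ideal) (auto simp: exponent_ideal_def)
  have ys_S: "set (ys as) \<subseteq> polys_on (exponents n)"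
    using ys_sub ideal_sub[OF is_ideal_var_ideal] by blast
  let ?L = "adjoins n ?Q (ys as)"
  have L: "is_ideal n ?L" using is_ideal_adjoins[OF Q ys_S] .
  define s :: "'k mpoly" where "s = Poly_Mapping.single u 1"
  have uE: "u \<in> exponents n" using u by (simp add: fixed_exponents_def)
  have s: "s \<in> polys_on (exponents n)" using uE by (simp add: s_def polys_on_single)
  have s_notin: "s \<notin> ?L"
    unfolding adj s_def reduced_ideal_def using u id by (simp add: polys_on_single_iff)
  have s_mult: "var v * s \<in> ?L" if v: "v < n" for v
  proof -
    have out: "var v * s \<in> ?L" if "v \<in> {..<n} - A" for v
    proof -
      have "u + Poly_Mapping.single v (Suc 0) \<in> F A" using u that by blast
      moreover have "\<pi> (u + Poly_Mapping.single v (Suc 0)) = u + Poly_Mapping.single v (Suc 0)"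
        using calculation FA id by blast
      ultimately show ?thesis
        unfolding adj s_def reduced_ideal_def var_def using uE that
        by (simp add: mult_single add.commute polys_on_single)
    qed
    show ?thesis
    proof (cases "v \<in> A")
      case True
      \<comment> \<open>An eliminated variable equals its partner modulo \<open>?L\<close>, so the
        socle condition for the surviving variables suffices.\<close>
      have "var v - var (\<beta> v) \<in> ?L"
        using adjoins_mem[OF Q ys_S] True as by (auto simp: ys_def)
      then have "(var v - var (\<beta> v)) * s + var (\<beta> v) * s \<in> ?L"
        using True A s by (intro ideal_add[OF L] ideal_mult_right[OF L] out) auto
      then show ?thesis by (simp add: left_diff_distrib)
    qed (use v out in auto)
  qed
  have "depth (ring_on (polys_on (exponents n))) (var_ideal n)
      (quot_module (regular_module (ring_on (polys_on (exponents n)))) ?Q) = enat (length (ys as))"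
    by (rule depth_quotient_eq[OF Q Q_sub one_notin_var_ideal ys_sub reg s s_notin s_mult])
  then show ?thesis
    unfolding poly_ring_eq[symmetric] graded_maximal_ideal_eq[symmetric]
    using as distinct_card[of as] by (simp add: ys_def)
qed

section \<open>The product ideal\<close>

text \<open>The exponent \<open>(i, p, q)\<close> belongs to the \<open>k\<close>-th power of
  \<open>(x\<^bsup>s+1\<^esup>, x y\<^bsup>s-1\<^esup> z, y\<^bsup>s\<^esup> z)\<close>; here \<open>k - \<kappa>\<close>, \<open>\<beta>\<close> and \<open>\<kappa> - \<beta>\<close> count the factors of
  each kind.\<close>

definition piece :: "nat \<Rightarrow> nat \<Rightarrow> nat \<Rightarrow> nat \<Rightarrow> nat \<Rightarrow> bool" where
  "piece s k i p q \<longleftrightarrow>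
    (\<exists>\<kappa> \<beta>. \<beta> \<le> \<kappa> \<and> \<kappa> \<le> k \<and> \<kappa> \<le> q \<and> s * \<kappa> \<le> p + \<beta> \<and> (s + 1) * (k - \<kappa>) + \<beta> \<le> i)"

text \<open>After z := y the ideal J_s becomes (x^(s+1), x y^s, y^(s+1)); this describes its k-th
  power.\<close>

definition merged_piece :: "nat \<Rightarrow> nat \<Rightarrow> nat \<Rightarrow> nat \<Rightarrow> bool" where
  "merged_piece s k i r \<longleftrightarrow> (\<exists>p q. p + q = r \<and> piece s k i p q)"

lemma pieceI:
  "\<beta> \<le> \<kappa> \<Longrightarrow> \<kappa> \<le> k \<Longrightarrow> \<kappa> \<le> q \<Longrightarrow> s * \<kappa> \<le> p + \<beta> \<Longrightarrow> (s + 1) * (k - \<kappa>) + \<beta> \<le> i \<Longrightarrow> piece s k i p q"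
  unfolding piece_def by blast

lemma piece_mono: "piece s k i p q \<Longrightarrow> i \<le> i' \<Longrightarrow> p \<le> p' \<Longrightarrow> q \<le> q' \<Longrightarrow> piece s k i' p' q'"
  unfolding piece_def by (meson add_le_mono1 le_trans)

lemma piece_zero: "piece s 0 0 p q"
  by (rule pieceI[of 0 0]) auto

lemma piece_add:
  assumes "piece s k i p q" "piece s k' i' p' q'"
  shows "piece s (k + k') (i + i') (p + p') (q + q')"
proof -
  obtain \<kappa> \<beta> where 1: "\<beta> \<le> \<kappa>" "\<kappa> \<le> k" "\<kappa> \<le> q" "s * \<kappa> \<le> p + \<beta>" "(s + 1) * (k - \<kappa>) + \<beta> \<le> i"
    using assms(1) unfolding piece_def by blast
  obtain \<kappa>' \<beta>' where 2: "\<beta>' \<le> \<kappa>'" "\<kappa>' \<le> k'" "\<kappa>' \<le> q'" "s * \<kappa>' \<le> p' + \<beta>'"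
    "(s + 1) * (k' - \<kappa>') + \<beta>' \<le> i'"
    using assms(2) unfolding piece_def by blast
  have "k + k' - (\<kappa> + \<kappa>') = (k - \<kappa>) + (k' - \<kappa>')" using 1 2 by simp
  then have "(s + 1) * (k + k' - (\<kappa> + \<kappa>')) = (s + 1) * (k - \<kappa>) + (s + 1) * (k' - \<kappa>')"
    by (simp only: distrib_left)
  moreover have "s * (\<kappa> + \<kappa>') = s * \<kappa> + s * \<kappa>'" by (rule distrib_left)
  ultimately show ?thesis
    using 1 2 by (intro pieceI[of "\<beta> + \<beta>'" "\<kappa> + \<kappa>'"]) linarith+
qed

text \<open>One generator is taken off a product of k + 1: an x^(s+1) if
  \<open>\<kappa> \<le> k\<close>, otherwise a y^s z if \<open>\<beta> \<le> k\<close>, and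
  otherwise an x y^(s-1) z, since all factors are then of that kind.\<close>

lemma piece_Suc_split:
  assumes s: "1 \<le> s" and "piece s (Suc k) i p q"
  shows "\<exists>i' p' q'. i' \<le> i \<and> p' \<le> p \<and> q' \<le> q \<and> piece s k (i - i') (p - p') (q - q') \<and> piece s 1 i' p' q'"
proof -
  obtain \<kappa> \<beta> where 1: "\<beta> \<le> \<kappa>" "\<kappa> \<le> Suc k" "\<kappa> \<le> q" "s * \<kappa> \<le> p + \<beta>" "(s + 1) * (Suc k - \<kappa>) + \<beta> \<le> i"
    using assms(2) unfolding piece_def by blast
  show ?thesis
  proof (cases "\<kappa> \<le> k")
    case True
    then have "(s + 1) * (Suc k - \<kappa>) = (s + 1) * (k - \<kappa>) + (s + 1)"
      by (simp add: Suc_diff_le)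
    then have "s + 1 \<le> i" "piece s k (i - (s + 1)) (p - 0) (q - 0)"
      using 1 True by (auto intro!: pieceI[of \<beta> \<kappa>])
    moreover have "piece s 1 (s + 1) 0 0" by (rule pieceI[of 0 0]) auto
    ultimately show ?thesis by blast
  next
    case False
    then have \<kappa>: "\<kappa> = Suc k" using 1 by simp
    show ?thesis
    proof (cases "\<beta> \<le> k")
      case True
      have "s \<le> p"
      proof -
        have "s * k \<ge> k" using s by (cases s) auto
        moreover have "s * \<kappa> = s + s * k" by (simp add: \<kappa>)
        ultimately show ?thesis using 1(4) True by linarith
      qed
      then have "piece s k (i - 0) (p - s) (q - 1)"
        using 1 \<kappa> True by (intro pieceI[of \<beta> k]) auto
      moreover have "piece s 1 0 s 1" by (rule pieceI[of 0 1]) auto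
      ultimately show ?thesis using \<open>s \<le> p\<close> 1 \<kappa> by (metis One_nat_def Suc_leD Suc_le_mono le0 le_trans)
    next
      case False
      then have \<beta>: "\<beta> = Suc k" using 1 \<kappa> by simp
      have "s * k \<ge> k" using s by (cases s) auto
      moreover have "s * \<kappa> = s + s * k" by (simp add: \<kappa>)
      ultimately have "s - 1 \<le> p" using 1(4) \<beta> by linarith
      moreover have "piece s k (i - 1) (p - (s - 1)) (q - 1)"
        using 1 \<kappa> \<beta> s calculation by (intro pieceI[of k k]) auto
      moreover have "piece s 1 1 (s - 1) 1"
        using s by (intro pieceI[of 1 1]) auto
      moreover have "1 \<le> i" "1 \<le> q" using 1 \<beta> \<kappa> by auto
      ultimately show ?thesis by blast
    qed
  qed
qed

text \<open>If the first product has \<open>\<kappa> \<le> q\<close> factors with z, it serves as it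
  is. Otherwise take q factors y^s z and k - q factors x^(s+1). There is enough y, because
  \<open>\<beta> \<le> \<kappa> \<le> k \<le> s\<close> and \<open>\<kappa> \<ge> q + 1\<close> turn
  \<open>s * \<kappa> \<le> p + \<beta>\<close> into \<open>s * q \<le> p\<close>. There is enough
  x, because the second product already has at least k - q factors x^(s+1).\<close>

lemma piece_saturated:
  assumes k: "k \<le> s" and 1: "piece s k i p (q + N)" and 2: "piece s k i' (p + N) q"
  shows "piece s k (max i i') p q"
proof -
  obtain \<kappa> \<beta> where \<kappa>: "\<beta> \<le> \<kappa>" "\<kappa> \<le> k" "s * \<kappa> \<le> p + \<beta>" "(s + 1) * (k - \<kappa>) + \<beta> \<le> i"
    using 1 unfolding piece_def by blast
  obtain \<kappa>' \<beta>' where \<kappa>': "\<kappa>' \<le> q" "(s + 1) * (k - \<kappa>') + \<beta>' \<le> i'"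
    using 2 unfolding piece_def by blast
  show ?thesis
  proof (cases "\<kappa> \<le> q")
    case True
    then show ?thesis using \<kappa> by (intro pieceI[of \<beta> \<kappa>]) auto
  next
    case False
    obtain d where d: "\<kappa> = Suc (q + d)" using False by (metis less_imp_Suc_add not_le)
    obtain r where r: "s = Suc (q + d) + r" using d \<kappa> k by (metis le_iff_add le_trans)
    have "s * q \<le> p"
    proof -
      have "s * q + s + s * d \<le> p + Suc (q + d)"
        using \<kappa> d by (simp add: algebra_simps)
      moreover have "s * d \<ge> d" using r by simp
      ultimately show ?thesis using r by linarith
    qed
    moreover have "(s + 1) * (k - q) \<le> (s + 1) * (k - \<kappa>')"
      using \<kappa>'(1) by (intro mult_le_mono2) simp
    then have "(s + 1) * (k - q) \<le> i'" using \<kappa>'(2) by linarith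
    ultimately show ?thesis
      using False \<kappa>(2) by (intro pieceI[of 0 q]) auto
  qed
qed

text \<open>At most s factors contain z. If there are s of them, the y-exponent s^2 - 1 is one short
  of s^2, so some factor is x y^(s-1) z and costs an additional x; if there are fewer, an additional
  x^(s+1) is needed.\<close>

lemma piece_corner_gt:
  assumes s: "1 \<le> s" "s < k" and piece: "piece s k i ((s + 1) * (s - 1)) s"
  shows "(s + 1) * (k - s) < i"
proof -
  obtain \<kappa> \<beta> where 1: "\<beta> \<le> \<kappa>" "\<kappa> \<le> k" "\<kappa> \<le> s" "s * \<kappa> \<le> (s + 1) * (s - 1) + \<beta>"
    "(s + 1) * (k - \<kappa>) + \<beta> \<le> i"
    using piece unfolding piece_def by blast
  show ?thesis
  proof (cases "\<kappa> = s")
    case True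
    then have "0 < \<beta>" using 1(4) s by (cases s) (auto simp: algebra_simps)
    then show ?thesis using 1 True by simp
  next
    case False
    then have "Suc (k - s) \<le> k - \<kappa>" using 1 s by linarith
    then have "(s + 1) * Suc (k - s) \<le> (s + 1) * (k - \<kappa>)" by (rule mult_le_mono2)
    moreover have "(s + 1) * (k - s) < (s + 1) * Suc (k - s)" by simp
    ultimately show ?thesis using 1(5) by (meson add_leD1 le_trans less_le_trans)
  qed
qed

text \<open>The products are (x y^(s-1) z) (y^s z)^(s-1), (y^s z)^s and (x y^(s-1) z)^(s+1), each
  completed to k factors by powers of x^(s+1).\<close>

lemma piece_corner:
  assumes s: "1 \<le> s" "s < k"
  defines "i \<equiv> (s + 1) * (k - s)" and "p \<equiv> (s + 1) * (s - 1)"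
  shows "piece s k (Suc i) p s" "piece s k i (Suc p) s" "piece s k i p (Suc s)"
proof -
  have p: "s * s = Suc p" using s by (cases s) (auto simp: p_def algebra_simps)
  have i: "(s + 1) * (k - Suc s) + (s + 1) = i"
  proof -
    obtain d where "k = Suc (s + d)" using s(2) less_imp_Suc_add by blast
    then show ?thesis by (simp add: i_def Suc_diff_le)
  qed
  show "piece s k (Suc i) p s"
    using s p by (intro pieceI[of 1 s]) (auto simp: i_def)
  show "piece s k i (Suc p) s"
    using s p by (intro pieceI[of 0 s]) (auto simp: i_def)
  show "piece s k i p (Suc s)"
    using s p i by (intro pieceI[of "Suc s" "Suc s"]) auto
qed

text \<open>Without x all k factors are y^s z, and each contributes s + 1 to the merged
  exponent.\<close>

lemma merged_piece_corner_gt: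
  assumes "1 \<le> k" "merged_piece s k i ((s + 1) * k - 1)"
  shows "0 < i"
proof (rule ccontr)
  assume "\<not> 0 < i"
  then obtain p q \<kappa> \<beta> where *: "p + q = (s + 1) * k - 1" "\<kappa> \<le> k" "\<kappa> \<le> q" "s * \<kappa> \<le> p + \<beta>"
    "(s + 1) * (k - \<kappa>) + \<beta> \<le> 0"
    using assms unfolding merged_piece_def piece_def by auto
  then have "\<kappa> = k" "\<beta> = 0" by auto
  then have "s * k \<le> p" "k \<le> q" using *(3,4) by auto
  moreover have "(s + 1) * k = s * k + k" by simp
  ultimately show False using *(1) assms(1) by linarith
qed

text \<open>Replacing one y^s z by x y^(s-1) z saves one y at the price of one x.\<close>

lemma merged_piece_corner:
  assumes "1 \<le> k" "1 \<le> s"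
  shows "merged_piece s k (Suc 0) ((s + 1) * k - 1)" "merged_piece s k 0 ((s + 1) * k)"
proof -
  have "1 \<le> s * k" using assms by (cases s; cases k) auto
  then have "s * k - 1 + k = (s + 1) * k - 1" "piece s k (Suc 0) (s * k - 1) k"
    using assms by (auto intro!: pieceI[of 1 k])
  then show "merged_piece s k (Suc 0) ((s + 1) * k - 1)"
    unfolding merged_piece_def by blast
  have "s * k + k = (s + 1) * k" "piece s k 0 (s * k) k"
    by (auto intro!: pieceI[of 0 k])
  then show "merged_piece s k 0 ((s + 1) * k)"
    unfolding merged_piece_def by blast
qed

section \<open>The product ideal and its powers\<close>

locale depth_construction =
  fixes c b :: nat and s :: "nat \<Rightarrow> nat"
  assumes s_pos: "\<And>j. j < c \<Longrightarrow> 1 \<le> s j"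
begin

text \<open>The variable \<open>0\<close> is shared by all factors, \<open>yv j\<close> and \<open>zv j\<close> belong to the factor \<open>j < c\<close>, and
  the last \<open>b\<close> variables do not occur in the ideal.\<close>

definition n :: nat where "n = 2 * c + 1 + b"

definition yv :: "nat \<Rightarrow> nat" where "yv j = 2 * j + 1"

definition zv :: "nat \<Rightarrow> nat" where "zv j = 2 * j + 2"

lemma var_simps [simp]:
  "yv i = yv j \<longleftrightarrow> i = j" "zv i = zv j \<longleftrightarrow> i = j" "yv i \<noteq> zv j" "zv i \<noteq> yv j"
  "yv i \<noteq> 0" "zv i \<noteq> 0" "0 < yv i" "0 < zv i" "i < c \<Longrightarrow> yv i \<le> 2 * c" "i < c \<Longrightarrow> zv i \<le> 2 * c"
  by (auto simp: yv_def zv_def) presburger+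

lemma var_cases:
  assumes "v \<le> 2 * c"
  obtains "v = 0" | j where "j < c" "v = yv j" | j where "j < c" "v = zv j"
proof -
  consider "v = 0" | "odd v" | "even v" "v \<noteq> 0" by blast
  then show thesis
  proof cases
    case 2
    then obtain j where "v = 2 * j + 1" by (auto elim: oddE)
    then show ?thesis using assms that(2)[of j] by (auto simp: yv_def)
  next
    case 3
    then obtain j where "v = 2 * j" "j \<noteq> 0" by (auto elim: evenE)
    then show ?thesis using assms that(3)[of "j - 1"] by (auto simp: zv_def)
  qed (rule that(1))
qed

definition layout :: "nat \<Rightarrow> (nat \<Rightarrow> nat) \<Rightarrow> (nat \<Rightarrow> nat) \<Rightarrow> (nat \<Rightarrow>\<^sub>0 nat)" where
  "layout m p q = Poly_Mapping.single 0 m +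
    (\<Sum>j<c. Poly_Mapping.single (yv j) (p j) + Poly_Mapping.single (zv j) (q j))"

lemma lookup_layout:
  "Poly_Mapping.lookup (layout m p q) 0 = m"
  "j < c \<Longrightarrow> Poly_Mapping.lookup (layout m p q) (yv j) = p j"
  "j < c \<Longrightarrow> Poly_Mapping.lookup (layout m p q) (zv j) = q j"
  "2 * c < v \<Longrightarrow> Poly_Mapping.lookup (layout m p q) v = 0"
proof -
  have sum: "Poly_Mapping.lookup (layout m p q) v = (if v = 0 then m else 0) +
      (\<Sum>j<c. (if yv j = v then p j else 0) + (if zv j = v then q j else 0))" for v
    by (auto simp: layout_def lookup_add lookup_sum lookup_single when_def intro!: sum.cong)
  show "Poly_Mapping.lookup (layout m p q) 0 = m"
    by (simp add: sum)
  show "Poly_Mapping.lookup (layout m p q) (yv j) = p j" if "j < c"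
    using that by (simp add: sum)
  show "Poly_Mapping.lookup (layout m p q) (zv j) = q j" if "j < c"
    using that by (simp add: sum)
  show "Poly_Mapping.lookup (layout m p q) v = 0" if "2 * c < v"
  proof -
    have "yv j \<noteq> v" "zv j \<noteq> v" if "j < c" for j
      using \<open>2 * c < v\<close> that var_simps(9,10)[of j] by linarith+
    then show ?thesis using that by (simp add: sum)
  qed
qed

lemma layout_mem: "layout m p q \<in> exponents n"
  unfolding exponents_iff n_def by (auto intro: lookup_layout(4))

definition factor :: "nat set \<Rightarrow> nat \<Rightarrow> nat \<Rightarrow> nat \<Rightarrow> (nat \<Rightarrow>\<^sub>0 nat) \<Rightarrow> bool" where
  "factor U k j i e \<longleftrightarrow>
    (if zv j \<in> U then merged_piece (s j) k i (Poly_Mapping.lookup e (yv j))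
     else piece (s j) k i (Poly_Mapping.lookup e (yv j)) (Poly_Mapping.lookup e (zv j)))"

text \<open>The numbers \<open>\<iota> j\<close> distribute the x-exponent over the factors J, and k
  is reserved for the factor x of the ideal. For \<open>U = {}\<close> these are the exponents of
  the k-th power; in general they are the images after the variables in U have been merged.\<close>

definition power_exponents :: "nat \<Rightarrow> nat set \<Rightarrow> (nat \<Rightarrow>\<^sub>0 nat) set" where
  "power_exponents k U = {e \<in> fixed_exponents n U.
    \<exists>\<iota>. k + (\<Sum>j<c. \<iota> j) \<le> Poly_Mapping.lookup e 0 \<and> (\<forall>j<c. factor U k j (\<iota> j) e)}"

lemma factor_cong:
  "Poly_Mapping.lookup e (yv j) = Poly_Mapping.lookup e' (yv j) \<Longrightarrow>
   Poly_Mapping.lookup e (zv j) = Poly_Mapping.lookup e' (zv j) \<Longrightarrow>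
   zv j \<in> U \<longleftrightarrow> zv j \<in> U' \<Longrightarrow> factor U k j i e \<longleftrightarrow> factor U' k j i e'"
  by (simp add: factor_def)

lemma power_exponents_empty:
  "power_exponents k {} = {e \<in> exponents n. \<exists>\<iota>. k + (\<Sum>j<c. \<iota> j) \<le> Poly_Mapping.lookup e 0 \<and>
    (\<forall>j<c. piece (s j) k (\<iota> j) (Poly_Mapping.lookup e (yv j)) (Poly_Mapping.lookup e (zv j)))}"
  by (simp add: power_exponents_def fixed_exponents_def factor_def)

lemma exponent_ideal_power_exponents: "exponent_ideal n (power_exponents k {})"
proof -
  have "e + g \<in> power_exponents k {}" if e: "e \<in> power_exponents k {}" and g: "g \<in> exponents n" for e g
  proof -
    obtain \<iota> where \<iota>: "k + (\<Sum>j<c. \<iota> j) \<le> Poly_Mapping.lookup e 0"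
      "\<And>j. j < c \<Longrightarrow> piece (s j) k (\<iota> j) (Poly_Mapping.lookup e (yv j)) (Poly_Mapping.lookup e (zv j))"
      using e unfolding power_exponents_empty by blast
    have "piece (s j) k (\<iota> j) (Poly_Mapping.lookup (e + g) (yv j)) (Poly_Mapping.lookup (e + g) (zv j))"
      if "j < c" for j
      using \<iota>(2)[OF that] by (rule piece_mono) (auto simp: lookup_add)
    then show ?thesis
      using e g \<iota>(1) unfolding power_exponents_empty by (auto simp: lookup_add intro!: exI[of _ \<iota>])
  qed
  then show ?thesis
    by (auto simp: exponent_ideal_def power_exponents_empty)
qed

lemma power_exponents_zero: "power_exponents 0 {} = exponents n"
  unfolding power_exponents_empty by (auto intro!: exI[of _ "\<lambda>_. 0"] piece_zero)

text \<open>The splitting is done in each factor separately. The x-parts add up correctly because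
  \<open>piece_Suc_split\<close> returns a part \<open>i' \<le> \<iota> j\<close> and leaves exactly
  the difference to the other k factors.\<close>

lemma power_exponents_Suc:
  "power_exponents (Suc k) {} = {e + g | e g. e \<in> power_exponents k {} \<and> g \<in> power_exponents 1 {}}"
proof (intro equalityI subsetI)
  fix e assume e: "e \<in> power_exponents (Suc k) {}"
  then obtain \<iota> where \<iota>: "Suc k + (\<Sum>j<c. \<iota> j) \<le> Poly_Mapping.lookup e 0"
    "\<And>j. j < c \<Longrightarrow> piece (s j) (Suc k) (\<iota> j) (Poly_Mapping.lookup e (yv j)) (Poly_Mapping.lookup e (zv j))"
    unfolding power_exponents_empty by blast
  have "\<exists>i' p' q'. j < c \<longrightarrow> i' \<le> \<iota> j \<and> p' \<le> Poly_Mapping.lookup e (yv j) \<and>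
      q' \<le> Poly_Mapping.lookup e (zv j) \<and>
      piece (s j) k (\<iota> j - i') (Poly_Mapping.lookup e (yv j) - p') (Poly_Mapping.lookup e (zv j) - q') \<and>
      piece (s j) 1 i' p' q'" for j
    using piece_Suc_split[OF s_pos \<iota>(2)] by blast
  then obtain i' p' q' where split: "\<And>j. j < c \<Longrightarrow> i' j \<le> \<iota> j \<and> p' j \<le> Poly_Mapping.lookup e (yv j) \<and>
      q' j \<le> Poly_Mapping.lookup e (zv j) \<and>
      piece (s j) k (\<iota> j - i' j) (Poly_Mapping.lookup e (yv j) - p' j) (Poly_Mapping.lookup e (zv j) - q' j) \<and>
      piece (s j) 1 (i' j) (p' j) (q' j)"
    by metis
  \<comment> \<open>The summand 1 is the share of the separate factor x; the rest collects what is
    split off from each J.\<close>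
  define g where "g = layout (1 + (\<Sum>j<c. i' j)) p' q'"
  have sum: "(\<Sum>j<c. \<iota> j - i' j) + (\<Sum>j<c. i' j) = (\<Sum>j<c. \<iota> j)"
    unfolding sum.distrib[symmetric] using split by (intro sum.cong) auto
  have "e - g + g = e"
  proof (rule poly_mapping_eqI)
    fix v
    have "Poly_Mapping.lookup g v \<le> Poly_Mapping.lookup e v"
    proof (cases "v \<le> 2 * c")
      case True
      then show ?thesis
        using split \<iota>(1) sum by (cases rule: var_cases) (auto simp: g_def lookup_layout)
    qed (simp add: g_def lookup_layout)
    then show "Poly_Mapping.lookup (e - g + g) v = Poly_Mapping.lookup e v"
      by (simp add: lookup_add lookup_minus)
  qed
  moreover have "g \<in> power_exponents 1 {}"
    using split unfolding power_exponents_empty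
    by (auto simp: g_def layout_mem lookup_layout intro!: exI[of _ i'])
  moreover have "e - g \<in> power_exponents k {}"
  proof -
    have "e - g \<in> exponents n"
      using e by (auto simp: power_exponents_empty exponents_iff lookup_minus)
    moreover have "k + (\<Sum>j<c. \<iota> j - i' j) \<le> Poly_Mapping.lookup (e - g) 0"
      using \<iota>(1) sum by (simp add: g_def lookup_layout lookup_minus)
    ultimately show ?thesis
      using split unfolding power_exponents_empty
      by (auto simp: g_def lookup_layout lookup_minus intro!: exI[of _ "\<lambda>j. \<iota> j - i' j"])
  qed
  ultimately show "e \<in> {e + g | e g. e \<in> power_exponents k {} \<and> g \<in> power_exponents 1 {}}"
    by (metis (mono_tags, lifting) mem_Collect_eq)
next
  fix d assume "d \<in> {e + g | e g. e \<in> power_exponents k {} \<and> g \<in> power_exponents 1 {}}"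
  then obtain e g where d: "d = e + g" and e: "e \<in> power_exponents k {}" and g: "g \<in> power_exponents 1 {}"
    by blast
  obtain \<iota> where \<iota>: "k + (\<Sum>j<c. \<iota> j) \<le> Poly_Mapping.lookup e 0"
    "\<And>j. j < c \<Longrightarrow> piece (s j) k (\<iota> j) (Poly_Mapping.lookup e (yv j)) (Poly_Mapping.lookup e (zv j))"
    using e unfolding power_exponents_empty by blast
  obtain \<iota>' where \<iota>': "1 + (\<Sum>j<c. \<iota>' j) \<le> Poly_Mapping.lookup g 0"
    "\<And>j. j < c \<Longrightarrow> piece (s j) 1 (\<iota>' j) (Poly_Mapping.lookup g (yv j)) (Poly_Mapping.lookup g (zv j))"
    using g unfolding power_exponents_empty by blast
  have "piece (s j) (Suc k) (\<iota> j + \<iota>' j) (Poly_Mapping.lookup d (yv j)) (Poly_Mapping.lookup d (zv j))"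
    if "j < c" for j
    using piece_add[OF \<iota>(2) \<iota>'(2), OF that that] by (simp add: d lookup_add)
  moreover have "Suc k + (\<Sum>j<c. \<iota> j + \<iota>' j) \<le> Poly_Mapping.lookup d 0"
    using \<iota>(1) \<iota>'(1) by (simp add: d lookup_add sum.distrib)
  moreover have "d \<in> exponents n"
    using e g by (simp add: d power_exponents_empty)
  ultimately show "d \<in> power_exponents (Suc k) {}"
    unfolding power_exponents_empty by (auto intro!: exI[of _ "\<lambda>j. \<iota> j + \<iota>' j"])
qed

definition depth_ideal :: "'k::field mpoly set" where
  "depth_ideal = polys_on (power_exponents 1 {})"

lemma monomial_ideal_depth_ideal: "monomial_ideal n (depth_ideal :: 'k::field mpoly set)"
  unfolding monomial_ideal_def depth_ideal_def
    polys_on_eq_genideal[OF exponent_ideal_power_exponents[of 1]] monomials_def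
  by (intro exI conjI refl image_mono) (auto simp: power_exponents_empty)

lemma depth_ideal_power:
  "depth_ideal [^]\<^bsub>ideals_set (poly_ring n)\<^esub> k = (polys_on (power_exponents k {}) :: 'k::field mpoly set)"
proof (induction k)
  case 0
  show ?case
    by (simp add: nat_pow_def ideals_set_def power_exponents_zero poly_ring_eq ring_on_def)
next
  case (Suc k)
  have "depth_ideal [^]\<^bsub>ideals_set (poly_ring n)\<^esub> Suc k = ideal_prod (poly_ring n)
      (depth_ideal [^]\<^bsub>ideals_set (poly_ring n)\<^esub> k) (depth_ideal :: 'k mpoly set)"
    by (simp add: nat_pow_def ideals_set_def)
  also have "\<dots> = polys_on (power_exponents (Suc k) {})"
    unfolding Suc.IH unfolding depth_ideal_def ideal_prod_polys_on power_exponents_Suc[of k] ..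
  finally show ?case .
qed

section \<open>The variables eliminated for the k-th power\<close>

definition merged_vars :: "nat \<Rightarrow> nat set" where
  "merged_vars k = zv ` {j. j < c \<and> k \<le> s j} \<union> {2 * c + 1..<n}"

text \<open>For \<open>a = zv j\<close> the predecessor of a is \<open>yv j\<close>; the variables
  outside the ideal are merged into x, which has number 0.\<close>

definition partner :: "nat \<Rightarrow> nat" where
  "partner a = (if a \<le> 2 * c then a - 1 else 0)"

lemma partner_zv: "j < c \<Longrightarrow> partner (zv j) = yv j"
  by (auto simp: partner_def zv_def yv_def)

lemma merged_vars_cases:
  assumes "a \<in> merged_vars k"
  obtains j where "j < c" "k \<le> s j" "a = zv j" | "2 * c < a" "a < n" "partner a = 0"
  using assms unfolding merged_vars_def partner_def by force

lemma card_merged_vars: "card (merged_vars k) = card {j. j < c \<and> k \<le> s j} + b"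
proof -
  have "card (merged_vars k) = card (zv ` {j. j < c \<and> k \<le> s j}) + card {2 * c + 1..<n}"
    unfolding merged_vars_def
    by (intro card_Un_disjoint) (auto dest: var_simps(10))
  also have "card (zv ` {j. j < c \<and> k \<le> s j}) = card {j. j < c \<and> k \<le> s j}"
    by (intro card_image inj_onI) simp
  finally show ?thesis by (simp add: n_def)
qed

text \<open>For \<open>zv j\<close>, a splitting p + q provided by \<open>merged_piece\<close> gives
  a preimage. A free variable occurs in no condition and merging it into x only raises the
  x-exponent, so the exponents without that variable are their own preimages.\<close>

lemma merge_power_exponents:
  assumes U: "U \<subseteq> merged_vars k" and a: "a \<in> merged_vars k - U"
  shows "power_exponents k (insert a U) = merge a (partner a) ` power_exponents k U"
  using a[THEN DiffD1]
proof (cases rule: merged_vars_cases)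
  case (1 j)
  have yU: "yv j \<notin> U"
  proof
    assume "yv j \<in> U"
    then have "yv j \<in> merged_vars k" using U by blast
    then show False
      using var_simps(9)[OF \<open>j < c\<close>] by (cases rule: merged_vars_cases) auto
  qed
  have zU: "zv j \<notin> U" using a 1 by simp
  have "yv j < n" "zv j < n" using \<open>j < c\<close> by (auto simp: n_def yv_def zv_def)
  show ?thesis
    unfolding \<open>a = zv j\<close> partner_zv[OF \<open>j < c\<close>]
  proof (intro equalityI subsetI)
    fix e assume "e \<in> power_exponents k (insert (zv j) U)"
    then obtain \<iota> where e: "e \<in> fixed_exponents n (insert (zv j) U)"
      and \<iota>: "k + (\<Sum>j<c. \<iota> j) \<le> Poly_Mapping.lookup e 0"
        "\<And>i. i < c \<Longrightarrow> factor (insert (zv j) U) k i (\<iota> i) e"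
      unfolding power_exponents_def by blast
    obtain p q where pq: "p + q = Poly_Mapping.lookup e (yv j)" "piece (s j) k (\<iota> j) p q"
      using \<iota>(2)[OF \<open>j < c\<close>] by (auto simp: factor_def merged_piece_def)
    define f where "f = Poly_Mapping.update (yv j) p (Poly_Mapping.update (zv j) q e)"
    have f: "Poly_Mapping.lookup f v = (if v = yv j then p else if v = zv j then q else Poly_Mapping.lookup e v)" for v
      by (simp add: f_def lookup_update)
    have "merge (zv j) (yv j) f = e"
      using e pq(1) by (intro poly_mapping_eqI) (auto simp: lookup_merge f fixed_exponents_def)
    moreover have "f \<in> fixed_exponents n U"
      using e yU zU \<open>yv j < n\<close> \<open>zv j < n\<close> by (auto simp: fixed_exponents_def exponents_iff f)
    moreover have "factor U k i (\<iota> i) f" if "i < c" for i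
    proof (cases "i = j")
      case True
      then show ?thesis using pq(2) zU by (simp add: factor_def f)
    next
      case False
      then show ?thesis
        using \<iota>(2)[OF that] by (subst factor_cong[of _ _ e _ "insert (zv j) U"]) (auto simp: f)
    qed
    ultimately show "e \<in> merge (zv j) (yv j) ` power_exponents k U"
      using \<iota>(1) unfolding power_exponents_def
      by (intro image_eqI[of _ _ f]) (auto simp: f intro!: exI[of _ \<iota>])
  next
    fix e assume "e \<in> merge (zv j) (yv j) ` power_exponents k U"
    then obtain f \<iota> where e: "e = merge (zv j) (yv j) f" and f: "f \<in> fixed_exponents n U"
      and \<iota>: "k + (\<Sum>j<c. \<iota> j) \<le> Poly_Mapping.lookup f 0" "\<And>i. i < c \<Longrightarrow> factor U k i (\<iota> i) f"
      unfolding power_exponents_def by blast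
    have "e \<in> fixed_exponents n (insert (zv j) U)"
      using f yU merge_mem[OF \<open>yv j < n\<close>] by (auto simp: e fixed_exponents_def lookup_merge)
    moreover have "factor (insert (zv j) U) k i (\<iota> i) e" if "i < c" for i
    proof (cases "i = j")
      case True
      then show ?thesis
        using \<iota>(2)[OF that] zU by (auto simp: e factor_def merged_piece_def lookup_merge)
    next
      case False
      then show ?thesis
        using \<iota>(2)[OF that] by (subst factor_cong[of _ _ f _ U]) (auto simp: e lookup_merge)
    qed
    ultimately show "e \<in> power_exponents k (insert (zv j) U)"
      using \<iota>(1) unfolding power_exponents_def by (auto simp: e lookup_merge intro!: exI[of _ \<iota>])
  qed
next
  case 2
  have ay: "yv j \<noteq> a" and az: "zv j \<noteq> a" if "j < c" for j
    using 2 var_simps(9,10)[OF that] by linarith+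
  have a0: "a \<noteq> 0" using 2 by simp
  have U0: "0 \<notin> U" using U by (auto simp: merged_vars_def)
  show ?thesis
    unfolding \<open>partner a = 0\<close>
  proof (intro equalityI subsetI)
    fix e assume e: "e \<in> power_exponents k (insert a U)"
    then have "merge a 0 e = e"
      using a0 by (intro merge_fixed) (auto simp: power_exponents_def fixed_exponents_def)
    moreover have "e \<in> power_exponents k U"
      using e az by (auto simp: power_exponents_def fixed_exponents_def factor_def)
    ultimately show "e \<in> merge a 0 ` power_exponents k U"
      by (intro image_eqI[of _ _ e]) simp_all
  next
    fix e assume "e \<in> merge a 0 ` power_exponents k U"
    then obtain f \<iota> where e: "e = merge a 0 f" and f: "f \<in> fixed_exponents n U"
      and \<iota>: "k + (\<Sum>j<c. \<iota> j) \<le> Poly_Mapping.lookup f 0" "\<And>i. i < c \<Longrightarrow> factor U k i (\<iota> i) f"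
      unfolding power_exponents_def by blast
    have "e \<in> fixed_exponents n (insert a U)"
      using f U0 merge_mem[of 0 n f a] by (auto simp: e fixed_exponents_def lookup_merge n_def)
    moreover have "factor (insert a U) k i (\<iota> i) e" if "i < c" for i
      using \<iota>(2)[OF that] ay az that by (subst factor_cong[of _ _ f _ U]) (auto simp: e lookup_merge)
    ultimately show "e \<in> power_exponents k (insert a U)"
      using \<iota>(1) a0 unfolding power_exponents_def
      by (auto simp: e lookup_merge intro!: exI[of _ \<iota>])
  qed
qed

text \<open>For \<open>zv j\<close> the bound k \<le> s j allows \<open>piece_saturated\<close>. A
  free variable occurs in no condition, so multiplying by its powers does not affect
  membership.\<close>

lemma power_exponents_saturated:
  assumes U: "U \<subseteq> merged_vars k" and a: "a \<in> merged_vars k - U" and v: "v \<in> fixed_exponents n U"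
    and va: "v + Poly_Mapping.single a N \<in> power_exponents k U"
    and vb: "v + Poly_Mapping.single (partner a) N \<in> power_exponents k U"
  shows "v \<in> power_exponents k U"
  using a[THEN DiffD1]
proof (cases rule: merged_vars_cases)
  case (1 j)
  have zU: "zv j \<notin> U" using a 1 by simp
  obtain \<iota> where \<iota>: "k + (\<Sum>j<c. \<iota> j) \<le> Poly_Mapping.lookup v 0"
    "\<And>i. i < c \<Longrightarrow> factor U k i (\<iota> i) (v + Poly_Mapping.single (zv j) N)"
    using va 1 unfolding power_exponents_def by (auto simp: lookup_add lookup_single)
  obtain \<iota>' where \<iota>': "k + (\<Sum>j<c. \<iota>' j) \<le> Poly_Mapping.lookup v 0"
    "\<And>i. i < c \<Longrightarrow> factor U k i (\<iota>' i) (v + Poly_Mapping.single (yv j) N)"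
    using vb 1 unfolding power_exponents_def by (auto simp: lookup_add lookup_single partner_zv)
  have other: "factor U k i (\<iota> i) v" "factor U k i (\<iota>' i) v" if "i < c" "i \<noteq> j" for i
  proof -
    have "factor U k i m (v + Poly_Mapping.single w N) \<longleftrightarrow> factor U k i m v"
      if "w = zv j \<or> w = yv j" for m w
      using that \<open>i \<noteq> j\<close> by (intro factor_cong) (auto simp: lookup_add lookup_single when_def)
    then show "factor U k i (\<iota> i) v" "factor U k i (\<iota>' i) v"
      using \<iota>(2)[OF that(1)] \<iota>'(2)[OF that(1)] by simp_all
  qed
  have "piece (s j) k (max (\<iota> j) (\<iota>' j)) (Poly_Mapping.lookup v (yv j)) (Poly_Mapping.lookup v (zv j))"
    using \<iota>(2)[OF \<open>j < c\<close>] \<iota>'(2)[OF \<open>j < c\<close>] zU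
    by (intro piece_saturated[OF \<open>k \<le> s j\<close>, of _ _ _ N]) (simp_all add: factor_def lookup_add lookup_single)
  then have max: "factor U k j (max (\<iota> j) (\<iota>' j)) v"
    using zU by (simp add: factor_def)
  \<comment> \<open>Away from j both distributions are valid for v, and both fit its x-exponent. The
    one with the larger value at j is therefore taken as a whole; mixing them might violate the
    bound on the sum.\<close>
  define \<mu> where "\<mu> = (if \<iota> j \<le> \<iota>' j then \<iota>' else \<iota>)"
  have "factor U k i (\<mu> i) v" if "i < c" for i
    using other[OF that] max by (cases "i = j") (auto simp: \<mu>_def max_def split: if_splits)
  moreover have "k + (\<Sum>j<c. \<mu> j) \<le> Poly_Mapping.lookup v 0"
    using \<iota>(1) \<iota>'(1) by (simp add: \<mu>_def)
  ultimately show ?thesis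
    using v unfolding power_exponents_def by blast
next
  case 2
  have "yv j \<noteq> a" "zv j \<noteq> a" if "j < c" for j
    using 2 var_simps(9,10)[OF that] by linarith+
  then have "factor U k i m (v + Poly_Mapping.single a N) \<longleftrightarrow> factor U k i m v" if "i < c" for i m
    using that by (intro factor_cong) (auto simp: lookup_add lookup_single when_def)
  moreover have "Poly_Mapping.lookup (v + Poly_Mapping.single a N) 0 = Poly_Mapping.lookup v 0"
    using 2 by (simp add: lookup_add lookup_single)
  ultimately show ?thesis
    using va v unfolding power_exponents_def by auto
qed

section \<open>The socle monomial\<close>

definition corner_level :: "nat \<Rightarrow> nat \<Rightarrow> nat" where
  "corner_level k j = (if k \<le> s j then 0 else (s j + 1) * (k - s j))"

text \<open>At these y- and z-exponents the factor j demands x-exponent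
  \<open>corner_level k j + 1\<close>. Over c factors the total is
  \<open>k + (\<Sum>j<c. corner_level k j) + c\<close>, and the monomial has one less; for k \<ge> 1
  the subtraction is not truncated, even if c = 0.\<close>

definition corner :: "nat \<Rightarrow> (nat \<Rightarrow>\<^sub>0 nat)" where
  "corner k = layout (k + (\<Sum>j<c. corner_level k j) + c - 1)
    (\<lambda>j. if k \<le> s j then (s j + 1) * k - 1 else (s j + 1) * (s j - 1))
    (\<lambda>j. if k \<le> s j then 0 else s j)"

lemma zv_merged_iff: "j < c \<Longrightarrow> zv j \<in> merged_vars k \<longleftrightarrow> k \<le> s j"
proof -
  assume "j < c"
  then have "zv j \<notin> {2 * c + 1..<n}"
    using var_simps(10)[OF \<open>j < c\<close>] unfolding atLeastLessThan_iff by linarith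
  then show ?thesis
    using \<open>j < c\<close> unfolding merged_vars_def by auto
qed

lemma factor_corner:
  assumes k: "1 \<le> k" and j: "j < c"
  shows "factor (merged_vars k) k j i (corner k) \<Longrightarrow> corner_level k j < i"
    and "factor (merged_vars k) k j (Suc (corner_level k j)) (corner k)"
    and "factor (merged_vars k) k j (corner_level k j) (corner k + Poly_Mapping.single (yv j) (Suc 0))"
    and "\<not> k \<le> s j \<Longrightarrow>
      factor (merged_vars k) k j (corner_level k j) (corner k + Poly_Mapping.single (zv j) (Suc 0))"
proof -
  have y: "Poly_Mapping.lookup (corner k) (yv j) =
      (if k \<le> s j then (s j + 1) * k - 1 else (s j + 1) * (s j - 1))"
    and z: "Poly_Mapping.lookup (corner k) (zv j) = (if k \<le> s j then 0 else s j)"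
    using j by (simp_all only: corner_def lookup_layout)
  have y': "Poly_Mapping.lookup (corner k + Poly_Mapping.single (yv j) (Suc 0)) (yv j) =
      Suc (Poly_Mapping.lookup (corner k) (yv j))"
    "Poly_Mapping.lookup (corner k + Poly_Mapping.single (zv j) (Suc 0)) (yv j) =
      Poly_Mapping.lookup (corner k) (yv j)"
    and z': "Poly_Mapping.lookup (corner k + Poly_Mapping.single (yv j) (Suc 0)) (zv j) =
      Poly_Mapping.lookup (corner k) (zv j)"
    "Poly_Mapping.lookup (corner k + Poly_Mapping.single (zv j) (Suc 0)) (zv j) =
      Suc (Poly_Mapping.lookup (corner k) (zv j))"
    by (simp_all add: lookup_add lookup_single)
  note unfold = factor_def zv_merged_iff[OF j] y' z' y z corner_level_def
  have pos: "1 \<le> s j" using s_pos[OF j] .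
  have top: "Suc ((s j + 1) * k - 1) = (s j + 1) * k" using k by simp
  show "corner_level k j < i" if "factor (merged_vars k) k j i (corner k)"
  proof (cases "k \<le> s j")
    case True
    then show ?thesis
      using that merged_piece_corner_gt[OF k, of "s j" i] unfolding unfold by simp
  next
    case False
    then show ?thesis
      using that piece_corner_gt[OF pos, of k i] unfolding unfold by simp
  qed
  have "factor (merged_vars k) k j (Suc (corner_level k j)) (corner k) \<and>
    factor (merged_vars k) k j (corner_level k j) (corner k + Poly_Mapping.single (yv j) (Suc 0))"
  proof (cases "k \<le> s j")
    case True
    then show ?thesis
      using merged_piece_corner[OF k pos] by (simp only: unfold True if_True top simp_thms)
  next
    case False
    then have "s j < k" by simp
    from piece_corner[OF pos this] False show ?thesis
      by (simp only: unfold if_False simp_thms)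
  qed
  then show "factor (merged_vars k) k j (Suc (corner_level k j)) (corner k)"
    "factor (merged_vars k) k j (corner_level k j) (corner k + Poly_Mapping.single (yv j) (Suc 0))"
    by simp_all
  show "factor (merged_vars k) k j (corner_level k j) (corner k + Poly_Mapping.single (zv j) (Suc 0))"
    if *: "\<not> k \<le> s j"
  proof -
    have "s j < k" using * by simp
    from piece_corner(3)[OF pos this] * show ?thesis
      by (simp only: unfold if_False)
  qed
qed

lemma corner_fixed: "corner k \<in> fixed_exponents n (merged_vars k)"
proof -
  have "Poly_Mapping.lookup (corner k) v = 0" if "v \<in> merged_vars k" for v
    using that by (cases rule: merged_vars_cases) (auto simp: corner_def lookup_layout)
  then show ?thesis
    by (simp add: fixed_exponents_def corner_def layout_mem)
qed

lemma corner_notin: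
  assumes "1 \<le> k"
  shows "corner k \<notin> power_exponents k (merged_vars k)"
proof
  assume "corner k \<in> power_exponents k (merged_vars k)"
  then obtain \<iota> where \<iota>: "k + (\<Sum>j<c. \<iota> j) \<le> Poly_Mapping.lookup (corner k) 0"
    "\<And>j. j < c \<Longrightarrow> factor (merged_vars k) k j (\<iota> j) (corner k)"
    unfolding power_exponents_def by blast
  have "(\<Sum>j<c. corner_level k j + 1) \<le> (\<Sum>j<c. \<iota> j)"
    using factor_corner(1)[OF assms _ \<iota>(2)] by (intro sum_mono) (simp add: Suc_leI)
  then show False
    using \<iota>(1) assms by (simp only: sum.distrib) (simp add: corner_def lookup_layout)
qed

lemma corner_add_var:
  assumes k: "1 \<le> k" and v: "v \<in> {..<n} - merged_vars k"
  shows "corner k + Poly_Mapping.single v (Suc 0) \<in> power_exponents k (merged_vars k)"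
proof -
  let ?e = "corner k + Poly_Mapping.single v (Suc 0)"
  have "?e \<in> fixed_exponents n (merged_vars k)"
    using corner_fixed[of k] v by (auto simp: fixed_exponents_def lookup_add lookup_single when_def)
  moreover have "\<exists>\<iota>. k + (\<Sum>j<c. \<iota> j) \<le> Poly_Mapping.lookup ?e 0 \<and>
      (\<forall>j<c. factor (merged_vars k) k j (\<iota> j) ?e)"
  proof -
    have "v \<le> 2 * c" using v by (auto simp: merged_vars_def)
    then consider "v = 0" | j where "j < c" "v = yv j \<or> v = zv j \<and> \<not> k \<le> s j"
      using v zv_merged_iff by (cases rule: var_cases) auto
    then show ?thesis
    \<comment> \<open>Multiplying by x supplies the one missing unit. Multiplying by a variable of
      the factor j instead lowers the demand of that factor by one.\<close>
    proof cases
      case 1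
      have "factor (merged_vars k) k j (Suc (corner_level k j)) ?e" if "j < c" for j
        using factor_corner(2)[OF k that] by (subst factor_cong[of _ _ "corner k"]) (auto simp: 1 lookup_add lookup_single)
      moreover have "k + (\<Sum>j<c. Suc (corner_level k j)) \<le> Poly_Mapping.lookup ?e 0"
        using k by (simp add: 1 corner_def lookup_layout lookup_add sum.distrib[of _ "\<lambda>_. Suc 0", simplified] sum_Suc)
      ultimately show ?thesis by blast
    next
      case (2 j)
      let ?\<iota> = "\<lambda>i. if i = j then corner_level k i else Suc (corner_level k i)"
      have "factor (merged_vars k) k i (?\<iota> i) ?e" if "i < c" for i
      proof (cases "i = j")
        case True
        then show ?thesis using factor_corner(3,4)[OF k \<open>j < c\<close>] 2 by auto
      next
        case False
        then show ?thesis
          using factor_corner(2)[OF k that] 2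
          by (subst factor_cong[of _ _ "corner k"]) (auto simp: lookup_add lookup_single when_def)
      qed
      moreover have "k + (\<Sum>i<c. ?\<iota> i) \<le> Poly_Mapping.lookup ?e 0"
      proof -
        have "(\<Sum>i<c. ?\<iota> i) + 1 = (\<Sum>i<c. corner_level k i) + c"
        proof -
          have "(\<Sum>i<c. ?\<iota> i) + 1 = (\<Sum>i<c. ?\<iota> i) + (\<Sum>i<c. if i = j then 1 else 0)"
            using \<open>j < c\<close> by simp
          also have "\<dots> = (\<Sum>i<c. corner_level k i + 1)"
            unfolding sum.distrib[symmetric] by (rule sum.cong) auto
          finally show ?thesis by (simp only: sum.distrib) simp
        qed
        then show ?thesis
          using 2 by (auto simp: corner_def lookup_layout lookup_add lookup_single)
      qed
      ultimately show ?thesis by blast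
    qed
  qed
  ultimately show ?thesis unfolding power_exponents_def by blast
qed

theorem depth_depth_ideal_power:
  assumes k: "1 \<le> k"
  shows "depth_quotient_power n (depth_ideal :: 'k::field mpoly set) k =
    enat (card {j. j < c \<and> k \<le> s j} + b)"
  unfolding depth_quotient_power_def depth_ideal_power card_merged_vars[symmetric]
proof (rule depth_monomial_quotient[where \<beta> = partner and F = "power_exponents k" and u = "corner k"])
  show "exponent_ideal n (power_exponents k {})" by (rule exponent_ideal_power_exponents)
  show "0 \<notin> power_exponents k {}" using k by (simp add: power_exponents_def)
  show "merged_vars k \<subseteq> {..<n}"
    by (auto simp: merged_vars_def n_def zv_def)
  show "partner ` merged_vars k \<subseteq> {..<n} - merged_vars k"
  proof
    fix v assume "v \<in> partner ` merged_vars k"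
    then obtain a where a: "a \<in> merged_vars k" "v = partner a" by blast
    from a(1) show "v \<in> {..<n} - merged_vars k"
      by (cases rule: merged_vars_cases)
        (auto simp: a(2) partner_zv merged_vars_def n_def, auto simp: yv_def zv_def)
  qed
qed (use k in \<open>simp_all add: merge_power_exponents power_exponents_saturated corner_fixed
  corner_notin corner_add_var\<close>)

end

section \<open>Realizing the given function\<close>

lemma initial_segment:
  fixes A :: "nat set"
  assumes "finite A" "0 \<notin> A" "\<And>i k. k \<in> A \<Longrightarrow> 1 \<le> i \<Longrightarrow> i \<le> k \<Longrightarrow> i \<in> A" "1 \<le> k"
  shows "k \<le> card A \<longleftrightarrow> k \<in> A"
proof (cases "A = {}")
  case False
  have "A = {1..Max A}"
  proof (intro equalityI subsetI)
    fix i assume "i \<in> A"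
    then show "i \<in> {1..Max A}" using assms by (auto simp: Suc_le_eq intro: gr0I)
  next
    fix i assume "i \<in> {1..Max A}"
    then show "i \<in> A" using assms(3)[of "Max A" i] Max_in[OF assms(1) False] by auto
  qed
  then have "card A = Max A" "k \<in> A \<longleftrightarrow> k \<le> Max A"
    using assms(4) by (metis card_atLeastAtMost diff_Suc_1, metis atLeastAtMost_iff)
  then show ?thesis by simp
qed (use assms in simp)

theorem theorem1p1:
  fixes f :: "nat \<Rightarrow> nat" and a b :: nat
  assumes "\<forall>k\<ge>1. f (k + 1) \<le> f k"
    and "\<forall>k\<ge>1. int (f k) - int (f (k + 1)) \<le> 1"
    and "a = f 1"
    and "f \<longlonglongrightarrow> b"
    and "\<forall>c. b + 1 \<le> c \<and> c + 1 \<le> a \<longrightarrow>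
           card {k. k \<ge> 1 \<and> f k = c + 1} \<le> card {k. k \<ge> 1 \<and> f k = c}"
  shows "\<exists>n\<ge>1. \<exists>I :: 'k::field mpoly set.
           monomial_ideal n I \<and> (\<forall>k\<ge>1. depth_quotient_power n I k = enat (f k))"
proof -
  have mono: "f k \<le> f i" if "1 \<le> i" "i \<le> k" for i k
    using that(2)
  proof (induction k rule: dec_induct)
    case (step k)
    then show ?case using assms(1) that(1) by (metis Suc_eq_plus1 le_trans)
  qed simp
  \<comment> \<open>Convergence in a discrete space means being eventually constant; this makes the
    sets \<open>A j\<close> finite.\<close>
  obtain K where K: "\<And>k. K \<le> k \<Longrightarrow> f k = b"
    using assms(4) unfolding tendsto_discrete eventually_sequentially by blast
  have bounds: "b \<le> f k" "f k \<le> a" if "1 \<le> k" for k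
    using mono[OF that, of "max k K"] mono[of 1 k] K[of "max k K"] that assms(3) by auto
  define A where "A j = {k. 1 \<le> k \<and> b + j < f k}" for j
  define s where "s j = card (A j)" for j
  \<comment> \<open>As f is nonincreasing, \<open>A j\<close> is an initial segment of the positive
    integers, so its size is the threshold up to which f exceeds b + j.\<close>
  have s_iff: "k \<le> s j \<longleftrightarrow> b + j < f k" if "1 \<le> k" for k j
  proof -
    have "A j \<subseteq> {..<K}"
    proof
      fix k assume "k \<in> A j"
      then show "k \<in> {..<K}" using K[of k] by (cases "K \<le> k") (auto simp: A_def)
    qed
    then have "finite (A j)" using finite_subset by blast
    moreover have "i \<in> A j" if "k \<in> A j" "1 \<le> i" "i \<le> k" for i k
      using mono[OF that(2,3)] that by (auto simp: A_def)
    ultimately have "k \<le> s j \<longleftrightarrow> k \<in> A j"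
      unfolding s_def using that by (intro initial_segment) (auto simp: A_def)
    then show ?thesis using that by (simp add: A_def)
  qed
  have s_pos: "1 \<le> s j" if "j < a - b" for j
    using s_iff[of 1 j] that assms(3) by simp
  then interpret depth_construction "a - b" b s
    by unfold_locales
  have "card {j. j < a - b \<and> k \<le> s j} + b = f k" if "1 \<le> k" for k
  proof -
    \<comment> \<open>The bound \<open>f k \<le> a\<close> ensures that all j below f k - b number
      an existing factor.\<close>
    have "j < a - b \<and> k \<le> s j \<longleftrightarrow> j < f k - b" for j
      unfolding s_iff[OF that] using bounds[OF that] by linarith
    then have "{j. j < a - b \<and> k \<le> s j} = {..<f k - b}" by blast
    then show ?thesis using bounds[OF that] by simp
  qed
  then have "\<forall>k\<ge>1. depth_quotient_power n (depth_ideal :: 'k mpoly set) k = enat (f k)"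
    using depth_depth_ideal_power by metis
  moreover have "1 \<le> n" by (simp add: n_def)
  ultimately show ?thesis
    using monomial_ideal_depth_ideal by blast
qed

end
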